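(* Let $p$ be a prime number, $G$ a transitive group of degree $n\in p\mathbb{Z}\setminus p^{2}\mathbb{Z}$, and $H$ a corresponding subgroup of $G$. Assume that a $p$-Sylow subgroup $S_{p}$ of $G$ is normal and that $S_{p}\cong (C_{p})^{m}$ for some $m\neq 2$. Then $\operatorname{Sha}_{\mathcal{D}}^{2}(G,J_{G/H})[p^{\infty}]=0$ for every admissible set $\mathcal{D}$ of subgroups of $G$.
   Context: A transitive group of degree $n$ is a subgroup of $\mathfrak{S}_n$ acting transitively on $\{1,\dots,n\}$; a corresponding subgroup is a point stabilizer. $J_{G/H}$ is the cokernel of $\mathbb{Z}\to\operatorname{Ind}_H^G\mathbb{Z}=\mathrm{Hom}_{\mathbb{Z}[H]}(\mathbb{Z}[G],\mathbb{Z})$, $1\mapsto$ constant function $1$. $\operatorname{Sha}^2_{\mathcal{D}}(G,M):=\ker\big(H^2(G,M)\to\bigoplus_{D\in\mathcal{D}}H^2(D,M)\big)$. A finite set of subgroups is admissible if it contains all cyclic subgroups and is stable under conjugation. $A[p^\infty]$ is the $p$-primary torsion part. *)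

theory Defs
  imports "HOL-Algebra.Sym_Groups" "HOL-Algebra.Group_Action" "HOL-Algebra.Free_Abelian_Groups"
    "HOL-Computational_Algebra.Primes"
begin

section \<open>Modules over a group and their second cohomology\<close>

text \<open>Modules are written multiplicatively, as commutative groups of HOL-Algebra.\<close>

locale group_module = group G + M: comm_group M
  for G :: "('g, 'x) monoid_scheme" (structure) and M :: "('m, 'y) monoid_scheme" +
  fixes act :: "'g \<Rightarrow> 'm \<Rightarrow> 'm"
  assumes act_hom: "g \<in> carrier G \<Longrightarrow> act g \<in> hom M M"
    and act_one: "x \<in> carrier M \<Longrightarrow> act \<one> x = x"
    and act_mult: "\<lbrakk>g \<in> carrier G; h \<in> carrier G; x \<in> carrier M\<rbrakk> \<Longrightarrow> act (g \<otimes> h) x = act g (act h x)"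

abbreviation restrict_group :: "('g, 'x) monoid_scheme \<Rightarrow> 'g set \<Rightarrow> ('g, 'x) monoid_scheme"
  where "restrict_group G D \<equiv> G\<lparr>carrier := D\<rparr>"

definition cochains1 :: "('g, 'x) monoid_scheme \<Rightarrow> ('m, 'y) monoid_scheme \<Rightarrow> ('g \<Rightarrow> 'm) monoid"
  where "cochains1 G M = product_group (carrier G) (\<lambda>_. M)"

definition cochains2 ::
    "('g, 'x) monoid_scheme \<Rightarrow> ('m, 'y) monoid_scheme \<Rightarrow> ('g \<times> 'g \<Rightarrow> 'm) monoid"
  where "cochains2 G M = product_group (carrier G \<times> carrier G) (\<lambda>_. M)"

definition cochains3 ::
    "('g, 'x) monoid_scheme \<Rightarrow> ('m, 'y) monoid_scheme \<Rightarrow> ('g \<times> 'g \<times> 'g \<Rightarrow> 'm) monoid"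
  where "cochains3 G M = product_group (carrier G \<times> carrier G \<times> carrier G) (\<lambda>_. M)"

text \<open>The differentials of the inhomogeneous standard complex; additively
  \<open>(d b)(g, h) = g b(h) - b(g h) + b(g)\<close> and
  \<open>(d c)(g, h, k) = g c(h, k) - c(g h, k) + c(g, h k) - c(g, h)\<close>.\<close>

definition diff1 ::
    "('g, 'x) monoid_scheme \<Rightarrow> ('m, 'y) monoid_scheme \<Rightarrow> ('g \<Rightarrow> 'm \<Rightarrow> 'm) \<Rightarrow>
     ('g \<Rightarrow> 'm) \<Rightarrow> ('g \<times> 'g \<Rightarrow> 'm)"
  where "diff1 G M act b = (\<lambda>(g, h) \<in> carrier G \<times> carrier G.
    act g (b h) \<otimes>\<^bsub>M\<^esub> inv\<^bsub>M\<^esub> b (g \<otimes>\<^bsub>G\<^esub> h) \<otimes>\<^bsub>M\<^esub> b g)"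

definition diff2 ::
    "('g, 'x) monoid_scheme \<Rightarrow> ('m, 'y) monoid_scheme \<Rightarrow> ('g \<Rightarrow> 'm \<Rightarrow> 'm) \<Rightarrow>
     ('g \<times> 'g \<Rightarrow> 'm) \<Rightarrow> ('g \<times> 'g \<times> 'g \<Rightarrow> 'm)"
  where "diff2 G M act c = (\<lambda>(g, h, k) \<in> carrier G \<times> carrier G \<times> carrier G.
    act g (c (h, k)) \<otimes>\<^bsub>M\<^esub> inv\<^bsub>M\<^esub> c (g \<otimes>\<^bsub>G\<^esub> h, k) \<otimes>\<^bsub>M\<^esub>
      c (g, h \<otimes>\<^bsub>G\<^esub> k) \<otimes>\<^bsub>M\<^esub> inv\<^bsub>M\<^esub> c (g, h))"

definition cocycles2 ::
    "('g, 'x) monoid_scheme \<Rightarrow> ('m, 'y) monoid_scheme \<Rightarrow> ('g \<Rightarrow> 'm \<Rightarrow> 'm) \<Rightarrow> ('g \<times> 'g \<Rightarrow> 'm) monoid"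
  where "cocycles2 G M act =
    (cochains2 G M)\<lparr>carrier := kernel (cochains2 G M) (cochains3 G M) (diff2 G M act)\<rparr>"

definition coboundaries2 ::
    "('g, 'x) monoid_scheme \<Rightarrow> ('m, 'y) monoid_scheme \<Rightarrow> ('g \<Rightarrow> 'm \<Rightarrow> 'm) \<Rightarrow> ('g \<times> 'g \<Rightarrow> 'm) set"
  where "coboundaries2 G M act = diff1 G M act ` carrier (cochains1 G M)"

definition H2 ::
    "('g, 'x) monoid_scheme \<Rightarrow> ('m, 'y) monoid_scheme \<Rightarrow> ('g \<Rightarrow> 'm \<Rightarrow> 'm) \<Rightarrow>
     ('g \<times> 'g \<Rightarrow> 'm) set monoid"
  where "H2 G M act = cocycles2 G M act Mod coboundaries2 G M act"

text \<open>The restriction of a class is the class of the restriction of any representative; the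
  classes obtained from the various representatives all agree, so their union is that class.\<close>

definition res2 ::
    "('g, 'x) monoid_scheme \<Rightarrow> ('m, 'y) monoid_scheme \<Rightarrow> ('g \<Rightarrow> 'm \<Rightarrow> 'm) \<Rightarrow> 'g set \<Rightarrow>
     ('g \<times> 'g \<Rightarrow> 'm) set \<Rightarrow> ('g \<times> 'g \<Rightarrow> 'm) set"
  where "res2 G M act D C =
    (\<Union>c\<in>C. coboundaries2 (restrict_group G D) M act
       #>\<^bsub>cocycles2 (restrict_group G D) M act\<^esub> restrict c (D \<times> D))"

definition Sha2 ::
    "'g set set \<Rightarrow> ('g, 'x) monoid_scheme \<Rightarrow> ('m, 'y) monoid_scheme \<Rightarrow> ('g \<Rightarrow> 'm \<Rightarrow> 'm) \<Rightarrow>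
     ('g \<times> 'g \<Rightarrow> 'm) set monoid"
  where "Sha2 \<D> G M act = (H2 G M act)\<lparr>carrier :=
    kernel (H2 G M act) (sum_group \<D> (\<lambda>D. H2 (restrict_group G D) M act))
      (\<lambda>C. \<lambda>D\<in>\<D>. res2 G M act D C)\<rparr>"

definition primary_torsion :: "nat \<Rightarrow> ('a, 'x) monoid_scheme \<Rightarrow> 'a set"
  where "primary_torsion p A = {x \<in> carrier A. \<exists>k::nat. x [^]\<^bsub>A\<^esub> (p ^ k) = \<one>\<^bsub>A\<^esub>}"


section \<open>The module \<open>J\<close>\<close>

text \<open>A \<open>\<int>[H]\<close>-linear map \<open>\<int>[G] \<rightarrow> M\<close> is identified with its restriction to the basis \<open>G\<close>, i.e.
  with a function \<open>f\<close> on \<open>G\<close> satisfying \<open>f (h g) = h f(g)\<close>; \<open>G\<close> acts by \<open>(g f)(x) = f (x g)\<close>.\<close>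

definition Ind ::
    "('g, 'x) monoid_scheme \<Rightarrow> 'g set \<Rightarrow> ('m, 'y) monoid_scheme \<Rightarrow> ('g \<Rightarrow> 'm \<Rightarrow> 'm) \<Rightarrow> ('g \<Rightarrow> 'm) monoid"
  where "Ind G H M act = (product_group (carrier G) (\<lambda>_. M))\<lparr>carrier :=
    {f \<in> carrier G \<rightarrow>\<^sub>E carrier M. \<forall>h\<in>H. \<forall>g\<in>carrier G. f (h \<otimes>\<^bsub>G\<^esub> g) = act h (f g)}\<rparr>"

definition Ind_act :: "('g, 'x) monoid_scheme \<Rightarrow> 'g \<Rightarrow> ('g \<Rightarrow> 'm) \<Rightarrow> ('g \<Rightarrow> 'm)"
  where "Ind_act G g f = (\<lambda>x\<in>carrier G. f (x \<otimes>\<^bsub>G\<^esub> g))"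

abbreviation Ind_int :: "('g, 'x) monoid_scheme \<Rightarrow> 'g set \<Rightarrow> ('g \<Rightarrow> int) monoid"
  where "Ind_int G H \<equiv> Ind G H integer_group (\<lambda>_ z. z)"

definition const_map :: "('g, 'x) monoid_scheme \<Rightarrow> int \<Rightarrow> ('g \<Rightarrow> int)"
  where "const_map G z = (\<lambda>x\<in>carrier G. z)"

definition J_mod :: "('g, 'x) monoid_scheme \<Rightarrow> 'g set \<Rightarrow> ('g \<Rightarrow> int) set monoid"
  where "J_mod G H = Ind_int G H Mod (const_map G ` carrier integer_group)"

definition J_act :: "('g, 'x) monoid_scheme \<Rightarrow> 'g \<Rightarrow> ('g \<Rightarrow> int) set \<Rightarrow> ('g \<Rightarrow> int) set"
  where "J_act G g C = Ind_act G g ` C"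


section \<open>Groups\<close>

definition transitive_group :: "nat \<Rightarrow> (nat \<Rightarrow> nat) monoid \<Rightarrow> bool"
  where "transitive_group n G \<longleftrightarrow>
    (\<exists>K. subgroup K (sym_group n) \<and> G = restrict_group (sym_group n) K) \<and>
    (\<forall>i\<in>{1..n}. \<forall>j\<in>{1..n}. \<exists>g\<in>carrier G. g i = j)"

definition corresponding_subgroup :: "nat \<Rightarrow> (nat \<Rightarrow> nat) monoid \<Rightarrow> (nat \<Rightarrow> nat) set \<Rightarrow> bool"
  where "corresponding_subgroup n G H \<longleftrightarrow> (\<exists>i\<in>{1..n}. H = stabilizer G (\<lambda>g. g) i)"

definition sylow_subgroup :: "nat \<Rightarrow> ('g, 'x) monoid_scheme \<Rightarrow> 'g set \<Rightarrow> bool"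
  where "sylow_subgroup p G S \<longleftrightarrow> subgroup S G \<and> card S = p ^ multiplicity p (order G)"

definition admissible :: "('g, 'x) monoid_scheme \<Rightarrow> 'g set set \<Rightarrow> bool"
  where "admissible G \<D> \<longleftrightarrow>
    finite \<D> \<and>
    (\<forall>D\<in>\<D>. subgroup D G) \<and>
    (\<forall>D. subgroup D G \<and> cyclic_group (restrict_group G D) \<longrightarrow> D \<in> \<D>) \<and>
    (\<forall>g\<in>carrier G. \<forall>D\<in>\<D>. g <#\<^bsub>G\<^esub> D #>\<^bsub>G\<^esub> inv\<^bsub>G\<^esub> g \<in> \<D>)"


section \<open>Well-definedness\<close>

context group_module begin

lemma act_closed [simp, intro]: "g \<in> carrier G \<Longrightarrow> x \<in> carrier M \<Longrightarrow> act g x \<in> carrier M"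
  using act_hom by (auto simp: hom_def)

lemma act_distrib: "\<lbrakk>g \<in> carrier G; x \<in> carrier M; y \<in> carrier M\<rbrakk> \<Longrightarrow>
    act g (x \<otimes>\<^bsub>M\<^esub> y) = act g x \<otimes>\<^bsub>M\<^esub> act g y"
  using act_hom by (auto simp: hom_def)

lemma act_inv: "\<lbrakk>g \<in> carrier G; x \<in> carrier M\<rbrakk> \<Longrightarrow> act g (inv\<^bsub>M\<^esub> x) = inv\<^bsub>M\<^esub> act g x"
  by (meson M.is_group act_hom group_hom.hom_inv group_hom_axioms_def group_hom_def)

lemma group_module_subgroup:
  assumes "subgroup D G" shows "group_module (restrict_group G D) M act"
proof -
  interpret D: group "restrict_group G D"
    using assms by (rule subgroup_imp_group)
  show ?thesis
    by unfold_locales (use subgroup.mem_carrier[OF assms] in \<open>auto simp: act_hom act_one act_mult\<close>)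
qed

lemma comm_group_cochains: "comm_group (product_group I (\<lambda>_. M))"
  by (rule group.group_comm_groupI) (auto simp: M.is_group M.m_comm PiE_iff intro!: restrict_ext)

lemma diff1_hom: "diff1 G M act \<in> hom (cochains1 G M) (cochains2 G M)"
  unfolding diff1_def cochains1_def cochains2_def hom_def
  by (auto simp: PiE_iff act_distrib M.inv_mult M.m_ac intro!: ext)

lemma diff2_hom: "diff2 G M act \<in> hom (cochains2 G M) (cochains3 G M)"
proof -
  have ac: "(a \<otimes>\<^bsub>M\<^esub> a') \<otimes>\<^bsub>M\<^esub> (b \<otimes>\<^bsub>M\<^esub> b') \<otimes>\<^bsub>M\<^esub> (c \<otimes>\<^bsub>M\<^esub> c') \<otimes>\<^bsub>M\<^esub> (d \<otimes>\<^bsub>M\<^esub> d') =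
      (a \<otimes>\<^bsub>M\<^esub> b \<otimes>\<^bsub>M\<^esub> c \<otimes>\<^bsub>M\<^esub> d) \<otimes>\<^bsub>M\<^esub> (a' \<otimes>\<^bsub>M\<^esub> b' \<otimes>\<^bsub>M\<^esub> c' \<otimes>\<^bsub>M\<^esub> d')"
    if "a \<in> carrier M" "b \<in> carrier M" "c \<in> carrier M" "d \<in> carrier M"
      "a' \<in> carrier M" "b' \<in> carrier M" "c' \<in> carrier M" "d' \<in> carrier M"
    for a b c d a' b' c' d'
    using that by (simp add: M.m_ac)
  show ?thesis
    unfolding diff2_def cochains2_def cochains3_def hom_def
    by (auto simp: PiE_iff act_distrib M.inv_mult intro!: ext ac)
qed

lemma diff2_diff1:
  assumes "b \<in> carrier (cochains1 G M)"
  shows "diff2 G M act (diff1 G M act b) = \<one>\<^bsub>cochains3 G M\<^esub>"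
proof -
  have b: "b g \<in> carrier M" if "g \<in> carrier G" for g
    using assms that by (auto simp: cochains1_def)
  have ac: "(x \<otimes>\<^bsub>M\<^esub> y' \<otimes>\<^bsub>M\<^esub> z) \<otimes>\<^bsub>M\<^esub> (x' \<otimes>\<^bsub>M\<^esub> w \<otimes>\<^bsub>M\<^esub> v') \<otimes>\<^bsub>M\<^esub>
      (y \<otimes>\<^bsub>M\<^esub> w' \<otimes>\<^bsub>M\<^esub> u) \<otimes>\<^bsub>M\<^esub> (z' \<otimes>\<^bsub>M\<^esub> v \<otimes>\<^bsub>M\<^esub> u')
      = (x \<otimes>\<^bsub>M\<^esub> x') \<otimes>\<^bsub>M\<^esub> (y \<otimes>\<^bsub>M\<^esub> y') \<otimes>\<^bsub>M\<^esub> (z \<otimes>\<^bsub>M\<^esub> z') \<otimes>\<^bsub>M\<^esub>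
        (w \<otimes>\<^bsub>M\<^esub> w') \<otimes>\<^bsub>M\<^esub> (v \<otimes>\<^bsub>M\<^esub> v') \<otimes>\<^bsub>M\<^esub> (u \<otimes>\<^bsub>M\<^esub> u')"
    if "x \<in> carrier M" "y \<in> carrier M" "z \<in> carrier M" "w \<in> carrier M" "v \<in> carrier M" "u \<in> carrier M"
      "x' \<in> carrier M" "y' \<in> carrier M" "z' \<in> carrier M" "w' \<in> carrier M" "v' \<in> carrier M" "u' \<in> carrier M"
    for x y z w v u x' y' z' w' v' u'
    using that by (simp add: M.m_ac)
  have cancel: "(x \<otimes>\<^bsub>M\<^esub> inv\<^bsub>M\<^esub> y \<otimes>\<^bsub>M\<^esub> z) \<otimes>\<^bsub>M\<^esub> inv\<^bsub>M\<^esub> (x \<otimes>\<^bsub>M\<^esub> inv\<^bsub>M\<^esub> w \<otimes>\<^bsub>M\<^esub> v) \<otimes>\<^bsub>M\<^esub>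
      (y \<otimes>\<^bsub>M\<^esub> inv\<^bsub>M\<^esub> w \<otimes>\<^bsub>M\<^esub> u) \<otimes>\<^bsub>M\<^esub> inv\<^bsub>M\<^esub> (z \<otimes>\<^bsub>M\<^esub> inv\<^bsub>M\<^esub> v \<otimes>\<^bsub>M\<^esub> u) = \<one>\<^bsub>M\<^esub>"
    if "x \<in> carrier M" "y \<in> carrier M" "z \<in> carrier M" "w \<in> carrier M" "v \<in> carrier M" "u \<in> carrier M"
    for x y z w v u
    using that ac[of x y z w v u "inv\<^bsub>M\<^esub> x" "inv\<^bsub>M\<^esub> y" "inv\<^bsub>M\<^esub> z" "inv\<^bsub>M\<^esub> w" "inv\<^bsub>M\<^esub> v" "inv\<^bsub>M\<^esub> u"]
    by (simp add: M.inv_mult)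
  show ?thesis
    unfolding diff1_def diff2_def cochains3_def
    by (auto simp: act_distrib act_inv act_mult [symmetric] b m_assoc intro!: ext cancel)
qed


lemma comm_group_cocycles2: "comm_group (cocycles2 G M act)"
  and subgroup_coboundaries2: "subgroup (coboundaries2 G M act) (cocycles2 G M act)"
proof -
  interpret C1: comm_group "cochains1 G M" unfolding cochains1_def by (rule comm_group_cochains)
  interpret C2: comm_group "cochains2 G M" unfolding cochains2_def by (rule comm_group_cochains)
  interpret C3: comm_group "cochains3 G M" unfolding cochains3_def by (rule comm_group_cochains)
  interpret d1: group_hom "cochains1 G M" "cochains2 G M" "diff1 G M act"
    by unfold_locales (rule diff1_hom)
  interpret d2: group_hom "cochains2 G M" "cochains3 G M" "diff2 G M act"
    by unfold_locales (rule diff2_hom)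
  have Z: "subgroup (kernel (cochains2 G M) (cochains3 G M) (diff2 G M act)) (cochains2 G M)"
    by (rule d2.subgroup_kernel)
  have B: "subgroup (coboundaries2 G M act) (cochains2 G M)"
    unfolding coboundaries2_def by (rule d1.img_is_subgroup)
  show "comm_group (cocycles2 G M act)"
    unfolding cocycles2_def
    by (rule group.group_comm_groupI[OF C2.subgroup_imp_group[OF Z]])
      (simp add: C2.m_comm kernel_def)
  have "coboundaries2 G M act \<subseteq> kernel (cochains2 G M) (cochains3 G M) (diff2 G M act)"
    using diff2_diff1 d1.hom_closed by (auto simp: coboundaries2_def kernel_def)
  then show "subgroup (coboundaries2 G M act) (cocycles2 G M act)"
    unfolding cocycles2_def by (intro C2.subgroup_incl B Z)
qed

lemma comm_group_H2: "comm_group (H2 G M act)"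
  unfolding H2_def by (rule comm_group.abelian_FactGroup[OF comm_group_cocycles2 subgroup_coboundaries2])

lemma restrict_cocycle:
  assumes D: "subgroup D G" and c: "c \<in> carrier (cocycles2 G M act)"
  shows "restrict c (D \<times> D) \<in> carrier (cocycles2 (restrict_group G D) M act)"
proof -
  let ?R = "restrict_group G D"
  have DG: "g \<in> carrier G" if "g \<in> D" for g using D that by (rule subgroup.mem_carrier)
  have e: "c \<in> carrier (cochains2 G M)" "diff2 G M act c = \<one>\<^bsub>cochains3 G M\<^esub>"
    using c by (auto simp: cocycles2_def kernel_def)
  have "diff2 ?R M act (restrict c (D \<times> D)) = restrict (diff2 G M act c) (D \<times> D \<times> D)"
    by (auto simp: diff2_def DG subgroup.m_closed[OF D] intro!: ext)
  also have "\<dots> = \<one>\<^bsub>cochains3 ?R M\<^esub>"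
    unfolding e(2) by (auto simp: cochains3_def DG intro!: ext)
  finally show ?thesis
    using e(1) by (auto simp: cocycles2_def kernel_def cochains2_def DG PiE_iff)
qed

lemma restrict_coboundary:
  assumes D: "subgroup D G" and c: "c \<in> coboundaries2 G M act"
  shows "restrict c (D \<times> D) \<in> coboundaries2 (restrict_group G D) M act"
proof -
  have DG: "g \<in> carrier G" if "g \<in> D" for g using D that by (rule subgroup.mem_carrier)
  obtain b where b: "b \<in> carrier (cochains1 G M)" "c = diff1 G M act b"
    using c by (auto simp: coboundaries2_def)
  have "restrict c (D \<times> D) = diff1 (restrict_group G D) M act (restrict b D)"
    unfolding b by (auto simp: diff1_def DG subgroup.m_closed[OF D] intro!: ext)
  moreover have "restrict b D \<in> carrier (cochains1 (restrict_group G D) M)"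
    using b(1) by (auto simp: cochains1_def DG PiE_iff)
  ultimately show ?thesis by (auto simp: coboundaries2_def)
qed

lemma restrict_mult:
  assumes D: "subgroup D G"
  shows "restrict (c \<otimes>\<^bsub>cocycles2 G M act\<^esub> c') (D \<times> D) =
    restrict c (D \<times> D) \<otimes>\<^bsub>cocycles2 (restrict_group G D) M act\<^esub> restrict c' (D \<times> D)"
  using subgroup.mem_carrier[OF D] by (auto simp: cocycles2_def cochains2_def intro!: ext)

lemma res2_rcoset:
  assumes D: "subgroup D G" and c: "c \<in> carrier (cocycles2 G M act)"
  shows "res2 G M act D (coboundaries2 G M act #>\<^bsub>cocycles2 G M act\<^esub> c) =
      coboundaries2 (restrict_group G D) M act
        #>\<^bsub>cocycles2 (restrict_group G D) M act\<^esub> restrict c (D \<times> D)"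
proof -
  let ?R = "restrict_group G D"
  let ?ZG = "cocycles2 G M act" and ?BG = "coboundaries2 G M act"
  let ?ZD = "cocycles2 ?R M act" and ?BD = "coboundaries2 ?R M act"
  interpret R: group_module ?R M act using D by (rule group_module_subgroup)
  interpret ZD: comm_group ?ZD by (rule R.comm_group_cocycles2)
  interpret ZG: comm_group ?ZG by (rule comm_group_cocycles2)
  have "?BD #>\<^bsub>?ZD\<^esub> restrict e (D \<times> D) = ?BD #>\<^bsub>?ZD\<^esub> restrict c (D \<times> D)"
    if e: "e \<in> ?BG #>\<^bsub>?ZG\<^esub> c" for e
  proof -
    obtain b where b: "b \<in> ?BG" "e = b \<otimes>\<^bsub>?ZG\<^esub> c"
      using e by (auto simp: r_coset_def)
    then have "restrict e (D \<times> D) \<in> ?BD #>\<^bsub>?ZD\<^esub> restrict c (D \<times> D)"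
      using restrict_coboundary[OF D b(1)] by (auto simp: restrict_mult[OF D] r_coset_def)
    then show ?thesis
      using ZD.repr_independence[OF _ restrict_cocycle[OF D c] R.subgroup_coboundaries2] by simp
  qed
  moreover have "c \<in> ?BG #>\<^bsub>?ZG\<^esub> c"
    by (rule ZG.rcos_self[OF c subgroup_coboundaries2])
  ultimately show ?thesis
    unfolding res2_def by blast
qed

lemma res2_hom:
  assumes D: "subgroup D G"
  shows "res2 G M act D \<in> hom (H2 G M act) (H2 (restrict_group G D) M act)"
proof -
  let ?R = "restrict_group G D"
  interpret R: group_module ?R M act using D by (rule group_module_subgroup)
  interpret ZG: comm_group "cocycles2 G M act" by (rule comm_group_cocycles2)
  interpret ZD: comm_group "cocycles2 ?R M act" by (rule R.comm_group_cocycles2)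
  interpret BG: normal "coboundaries2 G M act" "cocycles2 G M act"
    by (rule ZG.subgroup_imp_normal[OF subgroup_coboundaries2])
  interpret BD: normal "coboundaries2 ?R M act" "cocycles2 ?R M act"
    by (rule ZD.subgroup_imp_normal[OF R.subgroup_coboundaries2])
  show ?thesis
    by (rule homI)
      (auto simp: H2_def FactGroup_def RCOSETS_def res2_rcoset[OF D] restrict_cocycle[OF D]
        BG.rcos_sum BD.rcos_sum restrict_mult[OF D])
qed

end

text \<open>Evaluation on the basis identifies the \<open>\<int>[H]\<close>-linear maps \<open>\<int>[G] \<rightarrow> M\<close> with \<open>Ind G H M act\<close>.\<close>

lemma Hom_group_ring_Ind:
  fixes G (structure)
  assumes "group G" and H: "subgroup H G" and mod: "group_module (restrict_group G H) M act"
  shows "bij_betw (\<lambda>\<phi>. \<lambda>g\<in>carrier G. \<phi> (frag_of g))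
    {\<phi> \<in> hom (free_Abelian_group (carrier G)) M \<inter> extensional (carrier (free_Abelian_group (carrier G))).
       \<forall>h\<in>H. \<forall>x\<in>carrier (free_Abelian_group (carrier G)).
         \<phi> (frag_extend (\<lambda>g. frag_of (h \<otimes> g)) x) = act h (\<phi> x)}
    (carrier (Ind G H M act))"
    (is "bij_betw ?r ?A _")
proof -
  interpret group G by fact
  interpret mod: group_module "restrict_group G H" M act by fact
  let ?F = "free_Abelian_group (carrier G)"
  have HG: "h \<in> carrier G" if "h \<in> H" for h using H that by (rule subgroup.mem_carrier)
  have gh: "group_hom ?F M \<phi>" if "\<phi> \<in> hom ?F M" for \<phi>
    using that mod.M.is_group by (simp add: group_hom_def group_hom_axioms_def)
  have phi_diff: "\<phi> (x - y) = \<phi> x \<otimes>\<^bsub>M\<^esub> inv\<^bsub>M\<^esub> \<phi> y"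
    if "\<phi> \<in> hom ?F M" "x \<in> carrier ?F" "y \<in> carrier ?F" for \<phi> x y
    using group_hom.hom_mult[OF gh, of \<phi> x "-y"] group_hom.hom_inv[OF gh, of \<phi> y] that by simp
  have phi_zero: "\<phi> 0 = \<one>\<^bsub>M\<^esub>" if "\<phi> \<in> hom ?F M" for \<phi>
    using group_hom.hom_one[OF gh[OF that]] by simp
  have closed: "\<phi> x \<in> carrier M" if "\<phi> \<in> hom ?F M" "x \<in> carrier ?F" for \<phi> x
    using that by (auto simp: hom_def)
  have transl: "frag_extend (\<lambda>g. frag_of (h \<otimes> g)) x \<in> carrier ?F"
    if "h \<in> H" "x \<in> carrier ?F" for h x
    using that HG by (fastforce dest: subsetD[OF keys_frag_extend])
  show ?thesis
  proof (rule bij_betwI')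
    fix \<phi> \<psi> assume A: "\<phi> \<in> ?A" "\<psi> \<in> ?A"
    show "(?r \<phi> = ?r \<psi>) = (\<phi> = \<psi>)"
    proof
      assume eq: "?r \<phi> = ?r \<psi>"
      have e: "\<phi> (frag_of g) = \<psi> (frag_of g)" if "g \<in> carrier G" for g
        using fun_cong[OF eq, of g] that by simp
      have "\<phi> x = \<psi> x" if "x \<in> carrier ?F" for x
      proof -
        from that have "Poly_Mapping.keys x \<subseteq> carrier G" by simp
        then show ?thesis
        proof (induction rule: free_Abelian_group_induct [consumes 1, case_names zero diff single])
          case zero
          then show ?case using A phi_zero[of \<phi>] phi_zero[of \<psi>] by simp
        next
          case (diff x y)
          then show ?case using A phi_diff[of \<phi> x y] phi_diff[of \<psi> x y] by simp
        next
          case (single g)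
          then show ?case by (rule e)
        qed
      qed
      then show "\<phi> = \<psi>"
        using A by (auto intro: extensionalityI)
    qed simp
  next
    fix \<phi> assume A: "\<phi> \<in> ?A"
    have "\<phi> (frag_of (h \<otimes> g)) = act h (\<phi> (frag_of g))" if "h \<in> H" "g \<in> carrier G" for h g
    proof -
      have "\<phi> (frag_extend (\<lambda>g. frag_of (h \<otimes> g)) (frag_of g)) = act h (\<phi> (frag_of g))"
        using A that by (simp del: frag_extend_of)
      then show ?thesis by simp
    qed
    then show "?r \<phi> \<in> carrier (Ind G H M act)"
      using A closed HG by (auto simp: Ind_def)
  next
    fix f assume f: "f \<in> carrier (Ind G H M act)"
    then have "f ` carrier G \<subseteq> carrier M" by (auto simp: Ind_def)
    then obtain \<phi> where \<phi>: "\<phi> \<in> hom ?F M" "\<And>g. g \<in> carrier G \<Longrightarrow> \<phi> (frag_of g) = f g"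
      by (rule mod.M.free_Abelian_group_universal) blast
    have lin: "\<phi> (frag_extend (\<lambda>g. frag_of (h \<otimes> g)) x) = act h (\<phi> x)"
      if h: "h \<in> H" and x: "x \<in> carrier ?F" for h x
    proof -
      from x have "Poly_Mapping.keys x \<subseteq> carrier G" by simp
      then show ?thesis
      proof (induction rule: free_Abelian_group_induct [consumes 1, case_names zero diff single])
        case zero
        have "group_hom M M (act h)"
          using mod.act_hom h mod.M.is_group by (simp add: group_hom_def group_hom_axioms_def)
        then have "act h \<one>\<^bsub>M\<^esub> = \<one>\<^bsub>M\<^esub>" by (rule group_hom.hom_one)
        then show ?case using phi_zero[OF \<phi>(1)] by simp
      next
        case (diff x y)
        then show ?case
          using h transl[OF h] closed[OF \<phi>(1)]
          by (simp add: frag_extend_diff phi_diff[OF \<phi>(1)] mod.act_distrib mod.act_inv)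
      next
        case (single g)
        then show ?case using f h HG \<phi>(2) by (simp add: Ind_def)
      qed
    qed
    define \<psi> where "\<psi> = restrict \<phi> (carrier ?F)"
    have psi: "\<psi> x = \<phi> x" if "x \<in> carrier ?F" for x
      using that by (simp only: \<psi>_def restrict_apply')
    have "\<psi> \<in> hom ?F M"
    proof (rule homI)
      fix x y assume xy: "x \<in> carrier ?F" "y \<in> carrier ?F"
      then show "\<psi> (x \<otimes>\<^bsub>?F\<^esub> y) = \<psi> x \<otimes>\<^bsub>M\<^esub> \<psi> y"
        using monoid.m_closed[OF group.is_monoid[OF group_free_Abelian_group] xy]
          hom_mult[OF \<phi>(1) xy] by (simp only: psi)
    qed (simp only: psi closed[OF \<phi>(1)])
    moreover have "\<psi> \<in> extensional (carrier ?F)"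
      unfolding \<psi>_def by (rule restrict_extensional)
    moreover have "\<psi> (frag_extend (\<lambda>g. frag_of (h \<otimes> g)) x) = act h (\<psi> x)"
      if "h \<in> H" "x \<in> carrier ?F" for h x
      using lin[OF that] by (simp only: psi[OF that(2)] psi[OF transl[OF that]])
    ultimately have "\<psi> \<in> ?A" by blast
    moreover have "f = ?r \<psi>"
      using f \<phi>(2) by (auto simp: \<psi>_def Ind_def PiE_iff extensional_def intro!: ext)
    ultimately show "\<exists>\<psi>\<in>?A. f = ?r \<psi>" by blast
  qed
qed

lemma group_module_J:
  fixes G :: "('a, 'x) monoid_scheme" (structure)
  assumes "group G" and H: "subgroup H G"
  shows "group_module G (J_mod G H) (J_act G)"
    and "subgroup (const_map G ` carrier integer_group) (Ind_int G H)"
proof -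
  interpret group G by fact
  let ?P = "product_group (carrier G) (\<lambda>_. integer_group)"
  let ?I = "Ind_int G H" and ?K = "const_map G ` carrier integer_group"
  have HG: "h \<in> carrier G" if "h \<in> H" for h using H that by (rule subgroup.mem_carrier)
  interpret P: group ?P by simp
  have "subgroup (carrier ?I) ?P"
    by (rule P.subgroupI) (auto simp: Ind_def HG PiE_iff extensional_def split: if_splits intro!: exI[of _ "\<lambda>x\<in>carrier G. 0"])
  then have "group (?P\<lparr>carrier := carrier ?I\<rparr>)" by (rule P.subgroup_imp_group)
  then have "group ?I" by (simp add: Ind_def)
  then interpret I: comm_group ?I
    by (rule group.group_comm_groupI) (auto simp: Ind_def add.commute)
  have hom: "const_map G \<in> hom integer_group ?I"
    by (auto simp: hom_def Ind_def const_map_def HG intro!: ext)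
  interpret c: group_hom integer_group ?I "const_map G"
    using hom I.is_group by (simp add: group_hom_def group_hom_axioms_def)
  show K: "subgroup ?K ?I"
    by (rule c.img_is_subgroup)
  interpret K: normal ?K ?I by (rule I.subgroup_imp_normal[OF K])
  have cl: "Ind_act G g f \<in> carrier ?I" if "g \<in> carrier G" "f \<in> carrier ?I" for g f
    using that by (auto simp: Ind_def Ind_act_def HG m_assoc)
  have mult: "Ind_act G g (f \<otimes>\<^bsub>?I\<^esub> f') = Ind_act G g f \<otimes>\<^bsub>?I\<^esub> Ind_act G g f'"
    if "g \<in> carrier G" for g f f'
    using that by (auto simp: Ind_def Ind_act_def intro!: ext)
  have const: "Ind_act G g (const_map G z) = const_map G z" if "g \<in> carrier G" for g z
    using that by (auto simp: const_map_def Ind_act_def intro!: ext)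
  have J: "J_act G g (?K #>\<^bsub>?I\<^esub> f) = ?K #>\<^bsub>?I\<^esub> Ind_act G g f" if "g \<in> carrier G" for g f
    using that by (force simp: J_act_def r_coset_def mult const)
  have one: "Ind_act G \<one> f = f" if "f \<in> carrier ?I" for f
    using that by (auto simp: Ind_def Ind_act_def PiE_iff extensional_def intro!: ext)
  have comp: "Ind_act G (g \<otimes> h) f = Ind_act G g (Ind_act G h f)"
    if "g \<in> carrier G" "h \<in> carrier G" for g h and f :: "'a \<Rightarrow> int"
    using that by (auto simp: Ind_act_def m_assoc intro!: ext)
  interpret J: comm_group "J_mod G H"
    unfolding J_mod_def by (rule I.abelian_FactGroup[OF K])
  have carr: "C \<in> carrier (J_mod G H) \<longleftrightarrow> (\<exists>f\<in>carrier ?I. C = ?K #>\<^bsub>?I\<^esub> f)" for C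
    by (simp add: J_mod_def FactGroup_def RCOSETS_def)
  have cosets: "?K #>\<^bsub>?I\<^esub> f \<in> carrier (J_mod G H)" if "f \<in> carrier ?I" for f
    using that by (auto simp: carr)
  have sum: "(?K #>\<^bsub>?I\<^esub> f) \<otimes>\<^bsub>J_mod G H\<^esub> (?K #>\<^bsub>?I\<^esub> f') = ?K #>\<^bsub>?I\<^esub> (f \<otimes>\<^bsub>?I\<^esub> f')"
    if "f \<in> carrier ?I" "f' \<in> carrier ?I" for f f'
    using K.rcos_sum[OF that] by (simp add: J_mod_def FactGroup_def)
  show "group_module G (J_mod G H) (J_act G)"
  proof unfold_locales
    fix g assume g: "g \<in> carrier G"
    show "J_act G g \<in> hom (J_mod G H) (J_mod G H)"
    proof (rule homI)
      fix C assume "C \<in> carrier (J_mod G H)"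
      then obtain f where "f \<in> carrier ?I" "C = ?K #>\<^bsub>?I\<^esub> f" using carr[of C] by blast
      then show "J_act G g C \<in> carrier (J_mod G H)"
        using g by (simp only: J cosets cl)
    next
      fix C C' assume CC: "C \<in> carrier (J_mod G H)" "C' \<in> carrier (J_mod G H)"
      obtain f where "f \<in> carrier ?I" "C = ?K #>\<^bsub>?I\<^esub> f"
        using CC(1) carr[of C] by blast
      moreover obtain f' where "f' \<in> carrier ?I" "C' = ?K #>\<^bsub>?I\<^esub> f'"
        using CC(2) carr[of C'] by blast
      ultimately show "J_act G g (C \<otimes>\<^bsub>J_mod G H\<^esub> C') = J_act G g C \<otimes>\<^bsub>J_mod G H\<^esub> J_act G g C'"
        using g by (simp only: J sum cl mult)
    qed
  next
    fix C assume "C \<in> carrier (J_mod G H)"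
    then obtain f where "f \<in> carrier ?I" "C = ?K #>\<^bsub>?I\<^esub> f" using carr[of C] by blast
    then show "J_act G \<one> C = C" by (simp only: J one one_closed)
  next
    fix g h C assume "g \<in> carrier G" "h \<in> carrier G" "C \<in> carrier (J_mod G H)"
    moreover from this(3) obtain f where "f \<in> carrier ?I" "C = ?K #>\<^bsub>?I\<^esub> f" using carr[of C] by blast
    ultimately show "J_act G (g \<otimes> h) C = J_act G g (J_act G h C)"
      by (simp only: J comp m_closed)
  qed
qed

end

theory Submission
  imports Defs Complex_Main
begin

text \<open>
  Multiplication by \<open>[G : S]\<close>, which is prime to \<open>p\<close>, factors through restriction to \<open>S\<close> on cohomology,
  so it suffices that a class which is trivial on all cyclic subgroups is trivial on \<open>S\<close>. If \<open>m \<le> 1\<close> then \<open>S\<close> is cyclic.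

  Let \<open>m \<ge> 3\<close>. Since \<open>J\<close> becomes acyclic over \<open>\<real>\<close>, a class in \<open>H\<^sup>2(S, J)\<close> is given by a cocycle of degree
  one with values in the functions \<open>H \ G \<rightarrow> \<real>/\<int>\<close> modulo constants, that is, by
  functions \<open>B s\<close> with \<open>B t (x s) - B (s t) x + B s x = w s t\<close> independent of \<open>x\<close>. The class is trivial
  if and only if \<open>B s x = \<phi> (x s) - \<phi> x + \<mu> s\<close> for some \<open>\<phi>\<close> and \<open>\<mu>\<close>.

  As \<open>p\<^sup>2\<close> does not divide \<open>n\<close>, the stabilizers \<open>N x\<close> of points in \<open>S\<close> have index \<open>p\<close>, and they intersect
  trivially because \<open>G\<close> acts faithfully. Triviality on cyclic subgroups says that \<open>L s = B s x\<close> does not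
  depend on the point \<open>x\<close> fixed by \<open>s\<close>, so \<open>s \<mapsto> (s, L s)\<close> is a homomorphism from each \<open>N x\<close> to
  the extension of \<open>S\<close> by \<open>\<real>/\<int>\<close> with cocycle \<open>w\<close>. Choose stabilizers \<open>N1\<close>, \<open>N2\<close>, \<open>N3\<close> that are independent
  hyperplanes, which is possible for \<open>m \<ge> 3\<close>. Then \<open>N1 = (N1 \<inter> N2) (N1 \<inter> N3)\<close> and \<open>N2 = (N1 \<inter> N2) (N2 \<inter> N3)\<close>, so the images of
  \<open>N1\<close> and \<open>N2\<close> commute and the homomorphisms glue to one on \<open>S = N1 N2\<close>; it agrees with the given one on
  every \<open>N x\<close>. The resulting \<open>\<mu>\<close> splits \<open>w\<close>, and \<open>B - \<mu>\<close> is a coboundary by Shapiro's lemma.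
\<close>

section \<open>The circle group\<close>

\<comment> \<open>The circle is a type of its own so that it can be an instance of
  \<open>ab_group_add\<close>: the cocycle arguments below are carried out over an arbitrary such
  type and use its finite sums.\<close>
quotient_type circle = real / "\<lambda>x y :: real. x - y \<in> \<int>"
proof (rule equivpI)
  show "symp (\<lambda>x y :: real. x - y \<in> \<int>)"
    by (rule sympI) (use Ints_minus in fastforce)
  show "transp (\<lambda>x y :: real. x - y \<in> \<int>)"
    by (rule transpI) (use Ints_add in fastforce)
qed (simp add: reflp_def)

instantiation circle :: ab_group_add
begin

lift_definition zero_circle :: circle is 0 .

lift_definition plus_circle :: "circle \<Rightarrow> circle \<Rightarrow> circle" is "(+)"
proof -
  fix a b c d :: real assume "a - b \<in> \<int>" "c - d \<in> \<int>"
  then have "(a - b) + (c - d) \<in> \<int>" by (rule Ints_add)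
  then show "a + c - (b + d) \<in> \<int>" by (simp add: algebra_simps)
qed

lift_definition uminus_circle :: "circle \<Rightarrow> circle" is uminus
  by (metis Ints_minus minus_diff_minus)

lift_definition minus_circle :: "circle \<Rightarrow> circle \<Rightarrow> circle" is "(-)"
proof -
  fix a b c d :: real assume "a - b \<in> \<int>" "c - d \<in> \<int>"
  then have "(a - b) - (c - d) \<in> \<int>" by (rule Ints_diff)
  then show "a - c - (b - d) \<in> \<int>" by (simp add: algebra_simps)
qed

instance
  by standard (transfer, simp)+

end

lift_definition to_circle :: "real \<Rightarrow> circle" is "\<lambda>x. x" .

lemma to_circle_add: "to_circle (x + y) = to_circle x + to_circle y"
  and to_circle_diff: "to_circle (x - y) = to_circle x - to_circle y"
  and to_circle_eq_iff: "to_circle x = to_circle y \<longleftrightarrow> x - y \<in> \<int>"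
  by (transfer, simp)+

lemma to_circle_surj: "\<exists>x. to_circle x = a"
  by transfer (metis Ints_0 diff_self)

lemma to_circle_sum: "to_circle (sum f A) = (\<Sum>x\<in>A. to_circle (f x))"
proof -
  have "to_circle 0 = 0" by transfer simp
  then show ?thesis by (induction A rule: infinite_finite_induct) (simp_all add: to_circle_add)
qed

section \<open>Cocycles modulo constants\<close>

text \<open>This is triviality over \<open>D\<close> of a cochain of degree one in functions on the
  cosets H x modulo constants: \<phi> is the primitive, and \<mu> s is the constant lost by working
  modulo constants.\<close>

definition splits_on ::
    "('g, 'x) monoid_scheme \<Rightarrow> 'g set \<Rightarrow> 'g set \<Rightarrow> ('g \<Rightarrow> 'g \<Rightarrow> 'a::ab_group_add) \<Rightarrow> bool"
  where "splits_on G H D B \<longleftrightarrow> (\<exists>\<phi> \<mu>.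
    (\<forall>h\<in>H. \<forall>x\<in>carrier G. \<phi> (h \<otimes>\<^bsub>G\<^esub> x) = \<phi> x) \<and>
    (\<forall>s\<in>D. \<forall>x\<in>carrier G. B s x = \<phi> (x \<otimes>\<^bsub>G\<^esub> s) - \<phi> x + \<mu> s))"

lemma splits_onI:
  assumes "\<And>h x. \<lbrakk>h \<in> H; x \<in> carrier G\<rbrakk> \<Longrightarrow> \<phi> (h \<otimes>\<^bsub>G\<^esub> x) = \<phi> x"
    and "\<And>s x. \<lbrakk>s \<in> D; x \<in> carrier G\<rbrakk> \<Longrightarrow> B s x = \<phi> (x \<otimes>\<^bsub>G\<^esub> s) - \<phi> x + \<mu> s"
  shows "splits_on G H D B"
  using assms unfolding splits_on_def by blast

lemma splits_onE:
  assumes "splits_on G H D B"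
  obtains \<phi> \<mu> where "\<And>h x. \<lbrakk>h \<in> H; x \<in> carrier G\<rbrakk> \<Longrightarrow> \<phi> (h \<otimes>\<^bsub>G\<^esub> x) = \<phi> x"
    and "\<And>s x. \<lbrakk>s \<in> D; x \<in> carrier G\<rbrakk> \<Longrightarrow> B s x = \<phi> (x \<otimes>\<^bsub>G\<^esub> s) - \<phi> x + \<mu> s"
  using assms unfolding splits_on_def by blast

lemma splits_on_diff:
  assumes "splits_on G H D B" "splits_on G H D B'"
  shows "splits_on G H D (\<lambda>s x. B s x - B' s x)"
proof -
  obtain \<phi> \<mu> where
    "\<And>h x. \<lbrakk>h \<in> H; x \<in> carrier G\<rbrakk> \<Longrightarrow> \<phi> (h \<otimes>\<^bsub>G\<^esub> x) = \<phi> x"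
    "\<And>s x. \<lbrakk>s \<in> D; x \<in> carrier G\<rbrakk> \<Longrightarrow> B s x = \<phi> (x \<otimes>\<^bsub>G\<^esub> s) - \<phi> x + \<mu> s"
    using assms(1) by (rule splits_onE) blast
  moreover obtain \<phi>' \<mu>' where
    "\<And>h x. \<lbrakk>h \<in> H; x \<in> carrier G\<rbrakk> \<Longrightarrow> \<phi>' (h \<otimes>\<^bsub>G\<^esub> x) = \<phi>' x"
    "\<And>s x. \<lbrakk>s \<in> D; x \<in> carrier G\<rbrakk> \<Longrightarrow> B' s x = \<phi>' (x \<otimes>\<^bsub>G\<^esub> s) - \<phi>' x + \<mu>' s"
    using assms(2) by (rule splits_onE) blast
  ultimately show ?thesis
    by (intro splits_onI[where \<phi> = "\<lambda>x. \<phi> x - \<phi>' x" and \<mu> = "\<lambda>s. \<mu> s - \<mu>' s"]) simp_all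
qed

lemma splits_on_sum:
  fixes B :: "'i \<Rightarrow> 'g \<Rightarrow> 'g \<Rightarrow> 'a::ab_group_add"
  assumes "\<And>i. i \<in> I \<Longrightarrow> splits_on G H D (B i)"
  shows "splits_on G H D (\<lambda>s x. \<Sum>i\<in>I. B i s x)"
proof -
  have zero: "splits_on G H D (\<lambda>s x. 0 :: 'a)"
    by (rule splits_onI[where \<phi> = "\<lambda>_. 0" and \<mu> = "\<lambda>_. 0"]) simp_all
  show ?thesis
    using assms
  proof (induction I rule: infinite_finite_induct)
    case (insert i I)
    \<comment> \<open>Closure under differences suffices for sums: the new term is added by
      subtracting the negative of the remaining sum.\<close>
    then have "splits_on G H D (\<lambda>s x. B i s x - (0 - (\<Sum>i\<in>I. B i s x)))"
      by (intro splits_on_diff zero) simp_all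
    then show ?case using insert by simp
  qed (simp_all add: zero)
qed

text \<open>In a bare \<open>ab_group_add\<close> the multiple n c is written as a sum of n copies
  of c; this is (m n) c = m (n c).\<close>

lemma sum_lessThan_const_mult:
  fixes c :: "'a::comm_monoid_add" and m n :: nat
  shows "(\<Sum>i<m * n. c) = (\<Sum>j<m. \<Sum>i<n. c)"
proof (induction m)
  case (Suc m)
  have add: "(\<Sum>i<a + b. c) = (\<Sum>i<a. c) + (\<Sum>i<b. c)" for a b :: nat
    by (induction b) (simp_all add: ac_simps)
  show ?case using add[of n "m * n"] Suc by (simp add: ac_simps)
qed simp

text \<open>Bezout: if a k = b l + 1, then B = a (k B) - b (l B). For k = 0 coprimality forces l =
  1, and the second splitting is already the claim.\<close>

lemma splits_on_coprime:
  fixes k l :: nat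
  assumes "coprime k l" "splits_on G H D (\<lambda>s x. \<Sum>i<k. B s x)" "splits_on G H D (\<lambda>s x. \<Sum>i<l. B s x)"
  shows "splits_on G H D B"
proof (cases "k = 0")
  case True
  then show ?thesis using assms by simp
next
  case False
  then obtain a b where "k * a = l * b + gcd k l"
    using bezout_nat by blast
  then have ab: "a * k = Suc (b * l)" using assms(1) by (simp add: ac_simps)
  have "(\<Sum>j<a. \<Sum>i<k. B s x) - (\<Sum>j<b. \<Sum>i<l. B s x) = B s x" for s x
    unfolding sum_lessThan_const_mult[symmetric] ab by simp
  moreover have "splits_on G H D (\<lambda>s x. (\<Sum>j<a. \<Sum>i<k. B s x) - (\<Sum>j<b. \<Sum>i<l. B s x))"
    by (intro splits_on_diff splits_on_sum assms)
  ultimately show ?thesis by simp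
qed

text \<open>\<open>B\<close> is a cocycle of degree one with values in functions on the cosets H x
  modulo constants. The constants \<open>w\<close> by which it fails to be a genuine cocycle
  represent its image under the connecting homomorphism to degree two with constant
  coefficients.\<close>

locale twisted_cocycle = group G for G :: "('g, 'x) monoid_scheme" (structure) +
  fixes H :: "'g set" and B :: "'g \<Rightarrow> 'g \<Rightarrow> 'a::ab_group_add" and w :: "'g \<Rightarrow> 'g \<Rightarrow> 'a"
  assumes H_subgroup: "subgroup H G"
    and B_inv: "\<lbrakk>h \<in> H; g \<in> carrier G; x \<in> carrier G\<rbrakk> \<Longrightarrow> B g (h \<otimes> x) = B g x"
    and B_cocycle: "\<lbrakk>g \<in> carrier G; h \<in> carrier G; x \<in> carrier G\<rbrakk> \<Longrightarrow>
      B h (x \<otimes> g) - B (g \<otimes> h) x + B g x = w g h"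
begin

lemma H_closed: "h \<in> H \<Longrightarrow> h \<in> carrier G"
  using H_subgroup by (rule subgroup.mem_carrier)

lemma B_mult: "\<lbrakk>g \<in> carrier G; h \<in> carrier G; x \<in> carrier G\<rbrakk> \<Longrightarrow>
    B (g \<otimes> h) x = B h (x \<otimes> g) + B g x - w g h"
  using B_cocycle[of g h x] by (simp add: algebra_simps)

text \<open>The analogue of "corestriction after restriction is multiplication by the index k", made
  explicit: after subtracting the given coboundary, the cocycle modulo constants depends only on
  left cosets of \<open>S\<close>, and the cocycle relation is summed over a transversal.\<close>

lemma splits_on_transfer:
  assumes fin: "finite (carrier G)" and S: "subgroup S G" and split: "splits_on G H S B"
  obtains k where "k * card S = order G" "splits_on G H (carrier G) (\<lambda>g x. \<Sum>i<k. B g x)"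
proof -
  have SG: "s \<in> carrier G" if "s \<in> S" for s using S that by (rule subgroup.mem_carrier)
  obtain \<phi> \<mu> where \<phi>: "\<And>h x. \<lbrakk>h \<in> H; x \<in> carrier G\<rbrakk> \<Longrightarrow> \<phi> (h \<otimes> x) = \<phi> x"
    and \<mu>: "\<And>s x. \<lbrakk>s \<in> S; x \<in> carrier G\<rbrakk> \<Longrightarrow> B s x = \<phi> (x \<otimes> s) - \<phi> x + \<mu> s"
    using split by (rule splits_onE) blast
  \<comment> \<open>\<open>C\<close> is \<open>B\<close> minus the coboundary of \<phi>, so it has
    the same defect \<open>w\<close> and is constant in x on \<open>S\<close>.\<close>
  define C where "C g x = B g x - \<phi> (x \<otimes> g) + \<phi> x" for g x
  have C_S: "C s x = \<mu> s" if "s \<in> S" "x \<in> carrier G" for s x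
    using \<mu>[OF that] by (simp add: C_def)
  have C_mult: "C (g \<otimes> h) x = C h (x \<otimes> g) + C g x - w g h"
    if "g \<in> carrier G" "h \<in> carrier G" "x \<in> carrier G" for g h x
    using that by (simp add: C_def B_mult m_assoc algebra_simps)
  \<comment> \<open>The choice depends on the coset g S only as a set, so elements of one coset get
    the same representative; \<open>T\<close> is a transversal.\<close>
  define r where "r g = (SOME y. y \<in> g <# S)" for g
  define T where "T = r ` carrier G"
  have in_coset: "g \<otimes> s \<in> g <# S" if "s \<in> S" for g s
    using that by (auto simp: l_coset_def)
  have r_in: "r g \<in> g <# S" if "g \<in> carrier G" for g
    unfolding r_def by (rule someI[of _ "g \<otimes> \<one>"]) (rule in_coset[OF subgroup.one_closed[OF S]])
  have r_coset: "r g <# S = g <# S" if "g \<in> carrier G" for g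
    using l_repr_independence[OF r_in[OF that] that S] by simp
  have r_eq_iff: "r g = r h \<longleftrightarrow> g <# S = h <# S" if "g \<in> carrier G" "h \<in> carrier G" for g h
    using r_coset[OF that(1)] r_coset[OF that(2)] unfolding r_def by metis
  have r_closed: "r g \<in> carrier G" if "g \<in> carrier G" for g
    using r_in[OF that] that SG by (auto simp: l_coset_def)
  have TG: "t \<in> carrier G" "r t = t" if "t \<in> T" for t
    using that r_coset r_closed by (auto simp: T_def r_eq_iff)
  have r_mult: "r (g \<otimes> s) = r g" if "g \<in> carrier G" "s \<in> S" for g s
    using l_repr_independence[OF in_coset[OF that(2)] that(1) S] that SG by (simp add: r_eq_iff)
  have r_obtain: "\<exists>s\<in>S. r g \<otimes> s = g" if g: "g \<in> carrier G" for g
  proof -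
    obtain s where "s \<in> S" "r g = g \<otimes> s" using r_in[OF g] by (auto simp: l_coset_def)
    then show ?thesis
      using g SG by (intro bexI[of _ "inv s"]) (auto simp: m_assoc subgroup.m_inv_closed[OF S])
  qed
  have finT: "finite T" using fin by (simp add: T_def)
  have "bij_betw (\<lambda>(t, s). t \<otimes> s) (T \<times> S) (carrier G)"
  proof (rule bij_betw_imageI)
    show "inj_on (\<lambda>(t, s). t \<otimes> s) (T \<times> S)"
    proof (rule inj_onI, clarify)
      fix t s t' s' assume *: "t \<in> T" "s \<in> S" "t' \<in> T" "s' \<in> S" "t \<otimes> s = t' \<otimes> s'"
      then have "t = t'" using TG r_mult by metis
      then show "t = t' \<and> s = s'" using * TG SG by simp
    qed
    show "(\<lambda>(t, s). t \<otimes> s) ` (T \<times> S) = carrier G"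
    proof (intro equalityI subsetI)
      fix g assume "g \<in> carrier G"
      then show "g \<in> (\<lambda>(t, s). t \<otimes> s) ` (T \<times> S)"
        using r_obtain[of g] by (force simp: T_def)
    qed (use TG SG in auto)
  qed
  then have card: "card T * card S = order G"
    by (metis bij_betw_same_card card_cartesian_product order_def)
  have bij: "bij_betw (\<lambda>t. r (g \<otimes> t)) T T" if g: "g \<in> carrier G" for g
  proof -
    have "inj_on (\<lambda>t. r (g \<otimes> t)) T"
    proof (rule inj_onI)
      fix t t' assume *: "t \<in> T" "t' \<in> T" "r (g \<otimes> t) = r (g \<otimes> t')"
      then have t: "t \<in> carrier G" "t' \<in> carrier G" using TG by auto
      then have "(g \<otimes> t) <# S = (g \<otimes> t') <# S" using *(3) g r_eq_iff by simp
      then have "g \<otimes> t' \<in> (g \<otimes> t) <# S"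
        using g t in_coset[OF subgroup.one_closed[OF S], of "g \<otimes> t'"] by simp
      then obtain s where s: "s \<in> S" "g \<otimes> t' = g \<otimes> t \<otimes> s"
        unfolding l_coset_def by blast
      then have "t' = t \<otimes> s" using g t SG[OF s(1)] by (simp add: m_assoc)
      then show "t = t'" using * TG r_mult[OF t(1) s(1)] by metis
    qed
    moreover have "(\<lambda>t. r (g \<otimes> t)) ` T \<subseteq> T"
      using g TG(1) unfolding T_def by (intro image_subsetI imageI m_closed)
    ultimately show ?thesis using finT by (simp add: bij_betw_def endo_inj_surj)
  qed
  define e where "e x = (\<Sum>t\<in>T. C t x)" for x
  obtain \<sigma> where \<sigma>: "\<And>g. g \<in> carrier G \<Longrightarrow> \<sigma> g \<in> S" "\<And>g. g \<in> carrier G \<Longrightarrow> r g \<otimes> \<sigma> g = g"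
    using r_obtain by metis
  \<comment> \<open>Since g = \<open>r g\<close> times an element of \<open>S\<close>, the functions
    \<open>C g\<close> and \<open>C (r g)\<close> differ by a constant, and \<open>u g\<close> is
    that constant.\<close>
  define u where "u g = \<mu> (\<sigma> g) - w (r g) (\<sigma> g)" for g
  have u: "C g x = C (r g) x + u g" if g: "g \<in> carrier G" and x: "x \<in> carrier G" for g x
  proof -
    have "C (r g \<otimes> \<sigma> g) x = \<mu> (\<sigma> g) + C (r g) x - w (r g) (\<sigma> g)"
      using C_mult[of "r g" "\<sigma> g" x] C_S[of "\<sigma> g" "x \<otimes> r g"] SG \<sigma>(1) r_closed g x by simp
    then show ?thesis using \<sigma>(2)[OF g] by (simp add: u_def)
  qed
  \<comment> \<open>The cocycle relation for (g, t) is summed over t in \<open>T\<close>. Replacing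
    g t by its representative costs only constants, and t \<mapsto> r (g t) permutes
    \<open>T\<close>, so the first sum becomes \<open>e x\<close> again.\<close>
  have key: "(\<Sum>t\<in>T. C g x) = e x - e (x \<otimes> g) + (\<Sum>t\<in>T. u (g \<otimes> t) + w g t)"
    if "g \<in> carrier G" "x \<in> carrier G" for g x
  proof -
    have "C g x = C (r (g \<otimes> t)) x - C t (x \<otimes> g) + (u (g \<otimes> t) + w g t)" if "t \<in> T" for t
      using C_mult[of g t x] u[of "g \<otimes> t" x] TG that \<open>g \<in> carrier G\<close> \<open>x \<in> carrier G\<close>
      by (simp add: algebra_simps)
    then have "(\<Sum>t\<in>T. C g x) =
        (\<Sum>t\<in>T. C (r (g \<otimes> t)) x) - e (x \<otimes> g) + (\<Sum>t\<in>T. u (g \<otimes> t) + w g t)"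
      by (simp only: e_def sum.distrib sum_subtractf cong: sum.cong)
    then show ?thesis
      using sum.reindex_bij_betw[OF bij[OF that(1)], of "\<lambda>t. C t x"] by (simp add: e_def)
  qed
  have B_eq: "(\<Sum>t\<in>T. B g x) = (\<Sum>t\<in>T. C g x) + (\<Sum>t\<in>T. \<phi> (x \<otimes> g)) - (\<Sum>t\<in>T. \<phi> x)" for g x
    by (simp add: C_def sum.distrib sum_subtractf)
  have "splits_on G H (carrier G) (\<lambda>g x. \<Sum>t\<in>T. B g x)"
  proof (rule splits_onI[where \<phi> = "\<lambda>x. (\<Sum>t\<in>T. \<phi> x) - e x"
        and \<mu> = "\<lambda>g. \<Sum>t\<in>T. u (g \<otimes> t) + w g t"])
    fix h x assume "h \<in> H" "x \<in> carrier G"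
    then show "(\<Sum>t\<in>T. \<phi> (h \<otimes> x)) - e (h \<otimes> x) = (\<Sum>t\<in>T. \<phi> x) - e x"
      using TG H_closed by (simp add: e_def C_def \<phi> B_inv m_assoc)
  qed (simp add: key B_eq)
  moreover obtain f where "bij_betw f {0..<card T} T"
    using ex_bij_betw_nat_finite[OF finT] by blast
  then have "(\<Sum>t\<in>T. c) = (\<Sum>i<card T. c)" for c :: 'a
    using sum.reindex_bij_betw[of f _ T "\<lambda>_. c"] by (simp add: atLeast0LessThan)
  ultimately show thesis using card that by simp
qed

end


section \<open>Gluing homomorphisms\<close>

lemma (in group) mult_inv_cancel_left:
  assumes "x \<in> carrier G" "y \<in> carrier G"
  shows "inv x \<otimes> (x \<otimes> y) = y" "x \<otimes> (inv x \<otimes> y) = y"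
  using assms by (simp_all flip: m_assoc)

lemma (in group) card_dvd_card_subgroup:
  assumes "subgroup A G" "subgroup C G" "A \<subseteq> C"
  shows "card A dvd card C"
proof -
  have "card (rcosets\<^bsub>G\<lparr>carrier := C\<rparr>\<^esub> A) * card A = card C"
    using group.lagrange[OF subgroup_imp_group[OF assms(2)] subgroup_incl[OF assms]] by (simp add: order_def)
  from this[symmetric] show ?thesis by simp
qed

text \<open>The extension sends u v to \<sigma> u times \<sigma> v. If u v = u' v', the quotient of
  u by u' lies in both subgroups and can be moved from one factor to the other, because the same
  \<sigma> is multiplicative on each. Multiplicativity of the extension then needs the commutation
  of the values.\<close>

lemma (in group) hom_extend_product:
  assumes E: "group E" and N: "subgroup N G" "subgroup N' G"
    and comm: "\<And>u v. \<lbrakk>u \<in> N; v \<in> N'\<rbrakk> \<Longrightarrow> u \<otimes> v = v \<otimes> u"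
    and hom: "\<And>s t. \<lbrakk>s \<in> N; t \<in> N\<rbrakk> \<Longrightarrow> \<sigma> (s \<otimes> t) = \<sigma> s \<otimes>\<^bsub>E\<^esub> \<sigma> t"
      "\<And>s t. \<lbrakk>s \<in> N'; t \<in> N'\<rbrakk> \<Longrightarrow> \<sigma> (s \<otimes> t) = \<sigma> s \<otimes>\<^bsub>E\<^esub> \<sigma> t"
    and closed: "\<And>s. s \<in> N \<union> N' \<Longrightarrow> \<sigma> s \<in> carrier E"
    and ecomm: "\<And>u v. \<lbrakk>u \<in> N; v \<in> N'\<rbrakk> \<Longrightarrow> \<sigma> u \<otimes>\<^bsub>E\<^esub> \<sigma> v = \<sigma> v \<otimes>\<^bsub>E\<^esub> \<sigma> u"
  shows "\<exists>\<tau>. (\<forall>u\<in>N. \<forall>v\<in>N'. \<tau> (u \<otimes> v) = \<sigma> u \<otimes>\<^bsub>E\<^esub> \<sigma> v) \<and>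
    (\<forall>u\<in>N. \<forall>v\<in>N'. \<forall>u'\<in>N. \<forall>v'\<in>N'.
      \<tau> ((u \<otimes> v) \<otimes> (u' \<otimes> v')) = \<tau> (u \<otimes> v) \<otimes>\<^bsub>E\<^esub> \<tau> (u' \<otimes> v'))"
proof -
  interpret E: group E by fact
  have NG: "u \<in> carrier G" if "u \<in> N \<union> N'" for u
    using that subgroup.mem_carrier[OF N(1)] subgroup.mem_carrier[OF N(2)] by auto
  have wd: "\<sigma> u \<otimes>\<^bsub>E\<^esub> \<sigma> v = \<sigma> u' \<otimes>\<^bsub>E\<^esub> \<sigma> v'"
    if uv: "u \<in> N" "v \<in> N'" "u' \<in> N" "v' \<in> N'" and eq: "u \<otimes> v = u' \<otimes> v'" for u v u' v'
  proof -
    define d where "d = inv u' \<otimes> u"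
    have d: "d \<in> N" unfolding d_def using N uv by (simp add: subgroup.m_closed subgroup.m_inv_closed)
    have "d \<otimes> v = inv u' \<otimes> (u \<otimes> v)" using uv NG by (simp add: d_def m_assoc)
    also have "\<dots> = v'" using uv NG by (simp add: eq mult_inv_cancel_left)
    finally have dv: "d \<otimes> v = v'" .
    then have "d = v' \<otimes> inv v" using uv NG d by (metis UnI1 UnI2 inv_solve_right)
    then have d': "d \<in> N'" using N uv by (simp add: subgroup.m_closed subgroup.m_inv_closed)
    have "u' \<otimes> d = u" using uv NG by (simp add: d_def flip: m_assoc)
    then have "\<sigma> u \<otimes>\<^bsub>E\<^esub> \<sigma> v = \<sigma> u' \<otimes>\<^bsub>E\<^esub> \<sigma> d \<otimes>\<^bsub>E\<^esub> \<sigma> v" using hom(1)[of u' d] uv d by simp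
    also have "\<dots> = \<sigma> u' \<otimes>\<^bsub>E\<^esub> \<sigma> (d \<otimes> v)" using hom(2)[of d v] uv d d' closed by (simp add: E.m_assoc)
    finally show ?thesis by (simp add: dv)
  qed
  define \<tau> where "\<tau> s = (SOME y. \<exists>u\<in>N. \<exists>v\<in>N'. s = u \<otimes> v \<and> y = \<sigma> u \<otimes>\<^bsub>E\<^esub> \<sigma> v)" for s
  have \<tau>: "\<tau> (u \<otimes> v) = \<sigma> u \<otimes>\<^bsub>E\<^esub> \<sigma> v" if uv: "u \<in> N" "v \<in> N'" for u v
  proof -
    have "\<exists>a\<in>N. \<exists>b\<in>N'. u \<otimes> v = a \<otimes> b \<and> \<tau> (u \<otimes> v) = \<sigma> a \<otimes>\<^bsub>E\<^esub> \<sigma> b"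
      unfolding \<tau>_def by (rule someI[of _ "\<sigma> u \<otimes>\<^bsub>E\<^esub> \<sigma> v"]) (use uv in blast)
    then show ?thesis using wd uv by metis
  qed
  show ?thesis
  proof (intro exI[of _ \<tau>] conjI ballI \<tau>)
    fix u v u' v' assume uv: "u \<in> N" "v \<in> N'" "u' \<in> N" "v' \<in> N'"
    have "(u \<otimes> v) \<otimes> (u' \<otimes> v') = u \<otimes> (v \<otimes> u') \<otimes> v'" using uv NG by (simp add: m_assoc)
    also have "v \<otimes> u' = u' \<otimes> v" using comm[OF uv(3,2)] by simp
    also have "u \<otimes> (u' \<otimes> v) \<otimes> v' = (u \<otimes> u') \<otimes> (v \<otimes> v')" using uv NG by (simp add: m_assoc)
    finally have "\<tau> ((u \<otimes> v) \<otimes> (u' \<otimes> v')) = \<sigma> u \<otimes>\<^bsub>E\<^esub> (\<sigma> u' \<otimes>\<^bsub>E\<^esub> \<sigma> v) \<otimes>\<^bsub>E\<^esub> \<sigma> v'"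
      using uv N by (simp add: \<tau> subgroup.m_closed hom E.m_assoc closed)
    also have "\<sigma> u' \<otimes>\<^bsub>E\<^esub> \<sigma> v = \<sigma> v \<otimes>\<^bsub>E\<^esub> \<sigma> u'" using ecomm[OF uv(3,2)] .
    finally show "\<tau> ((u \<otimes> v) \<otimes> (u' \<otimes> v')) = \<tau> (u \<otimes> v) \<otimes>\<^bsub>E\<^esub> \<tau> (u' \<otimes> v')"
      using uv by (simp add: \<tau> E.m_assoc closed)
  qed
qed

text \<open>The assumption \<open>maximal\<close> expresses that S/N is generated by the image of
  any a outside N, in a form that yields explicit factorizations. The elements \<open>a\<close> and
  \<open>b\<close> witness that \<open>N1\<close>, \<open>N2\<close>, \<open>N3\<close> are
  independent: \<open>a\<close> separates \<open>N1\<close> from \<open>N2\<close>, and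
  \<open>b\<close> separates the intersection of \<open>N1\<close> and \<open>N2\<close> from
  \<open>N3\<close>.\<close>

lemma (in group) hom_amalgam_maximal:
  assumes E: "group E" and S: "subgroup S G"
    and comm: "\<And>s t. \<lbrakk>s \<in> S; t \<in> S\<rbrakk> \<Longrightarrow> s \<otimes> t = t \<otimes> s"
    and sub: "\<And>N. N \<in> \<N> \<Longrightarrow> subgroup N G" "\<And>N. N \<in> \<N> \<Longrightarrow> N \<subseteq> S"
    and maximal: "\<And>N a s. \<lbrakk>N \<in> \<N>; a \<in> S; a \<notin> N; s \<in> S\<rbrakk> \<Longrightarrow> \<exists>k::int. s \<otimes> a [^] k \<in> N"
    and hom: "\<And>N s t. \<lbrakk>N \<in> \<N>; s \<in> N; t \<in> N\<rbrakk> \<Longrightarrow> \<sigma> (s \<otimes> t) = \<sigma> s \<otimes>\<^bsub>E\<^esub> \<sigma> t"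
    and closed: "\<And>N s. \<lbrakk>N \<in> \<N>; s \<in> N\<rbrakk> \<Longrightarrow> \<sigma> s \<in> carrier E"
    and N: "N1 \<in> \<N>" "N2 \<in> \<N>" "N3 \<in> \<N>"
    and a: "a \<in> N1" "a \<notin> N2" and b: "b \<in> N1" "b \<in> N2" "b \<notin> N3"
  obtains \<tau> where "\<And>s. s \<in> S \<Longrightarrow> \<exists>u\<in>N1. \<exists>v\<in>N2. s = u \<otimes> v"
    and "\<And>s t. \<lbrakk>s \<in> S; t \<in> S\<rbrakk> \<Longrightarrow> \<tau> (s \<otimes> t) = \<tau> s \<otimes>\<^bsub>E\<^esub> \<tau> t"
    and "\<And>N s. \<lbrakk>N \<in> \<N>; s \<in> N\<rbrakk> \<Longrightarrow> \<tau> s = \<sigma> s"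
proof -
  interpret E: group E by fact
  have NS: "s \<in> S" if "N \<in> \<N>" "s \<in> N" for N s using sub that by blast
  have SG: "s \<in> carrier G" if "s \<in> S" for s using S that by (rule subgroup.mem_carrier)
  have one: "\<sigma> \<one> = \<one>\<^bsub>E\<^esub>"
  proof -
    have "\<one> \<in> N1" using sub N subgroup.one_closed by blast
    then show ?thesis using hom[OF N(1), of \<one> \<one>] closed[OF N(1), of \<one>] by simp
  qed
  have ecomm: "\<sigma> s \<otimes>\<^bsub>E\<^esub> \<sigma> t = \<sigma> t \<otimes>\<^bsub>E\<^esub> \<sigma> s" if "M \<in> \<N>" "s \<in> M" "t \<in> M" for M s t
    using hom that comm NS by metis
  \<comment> \<open>M is the product of its intersections with M' and M'': a power of c moves s into
    M'', and the inverse of that power lies in M and M'.\<close>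
  have factor: "\<exists>u v. u \<in> M \<and> u \<in> M' \<and> v \<in> M \<and> v \<in> M'' \<and> s = u \<otimes> v"
    if M: "M \<in> \<N>" "M' \<in> \<N>" "M'' \<in> \<N>" and c: "c \<in> M" "c \<in> M'" "c \<notin> M''" and s: "s \<in> M"
    for M M' M'' c s
  proof -
    obtain k :: int where k: "s \<otimes> c [^] k \<in> M''" using maximal[OF M(3) _ c(3)] NS M c s by blast
    define d where "d = c [^] k"
    have d: "d \<in> M" "d \<in> M'" "d \<in> carrier G" "s \<in> carrier G"
      using subgroup_int_pow_closed sub(1) M c NS SG s by (auto simp: d_def)
    have "s = s \<otimes> d \<otimes> inv d" using d by (simp add: m_assoc)
    also have "\<dots> = inv d \<otimes> (s \<otimes> d)"
      by (intro comm NS[OF M(1)] subgroup.m_closed[OF sub(1)] subgroup.m_inv_closed[OF sub(1)] M d s)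
    finally have "s = inv d \<otimes> (s \<otimes> d)" .
    moreover have "inv d \<in> M" "inv d \<in> M'" "s \<otimes> d \<in> M"
      using sub(1) M d s by (auto intro: subgroup.m_closed subgroup.m_inv_closed)
    ultimately show ?thesis using k unfolding d_def by blast
  qed
  have product: "\<exists>u\<in>N1. \<exists>v\<in>N2. s = u \<otimes> v" if s: "s \<in> S" for s
  proof -
    obtain k :: int where k: "s \<otimes> a [^] k \<in> N2" using maximal[OF N(2) _ a(2) s] NS N a by blast
    define d where "d = a [^] k"
    have d: "d \<in> N1" "d \<in> S" "d \<in> carrier G" "s \<in> carrier G"
      using subgroup_int_pow_closed sub(1) N a NS SG s by (auto simp: d_def)
    have "s = s \<otimes> d \<otimes> inv d" using d by (simp add: m_assoc)
    also have "\<dots> = inv d \<otimes> (s \<otimes> d)"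
      by (intro comm subgroup.m_closed[OF S] subgroup.m_inv_closed[OF S] d s)
    finally have "s = inv d \<otimes> (s \<otimes> d)" .
    moreover have "inv d \<in> N1"
      using sub(1) N d s by (auto intro: subgroup.m_inv_closed)
    ultimately show ?thesis using k unfolding d_def by blast
  qed
  \<comment> \<open>Each pair of factors lies in a common subgroup of the family: \<open>u1\<close>
    and v in \<open>N2\<close>, \<open>u2\<close> and \<open>v1\<close> in \<open>N1\<close>,
    \<open>u2\<close> and \<open>v2\<close> in \<open>N3\<close>. On a common subgroup the values
    commute because S is abelian.\<close>
  have N12: "\<sigma> u \<otimes>\<^bsub>E\<^esub> \<sigma> v = \<sigma> v \<otimes>\<^bsub>E\<^esub> \<sigma> u" if uv: "u \<in> N1" "v \<in> N2" for u v
  proof -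
    obtain u1 u2 where u: "u1 \<in> N1" "u1 \<in> N2" "u2 \<in> N1" "u2 \<in> N3" "u = u1 \<otimes> u2"
      using factor[OF N b uv(1)] by blast
    obtain v1 v2 where v: "v1 \<in> N2" "v1 \<in> N1" "v2 \<in> N2" "v2 \<in> N3" "v = v1 \<otimes> v2"
      using factor[OF N(2,1,3) b(2,1,3) uv(2)] by blast
    have cl: "\<sigma> u1 \<in> carrier E" "\<sigma> u2 \<in> carrier E" "\<sigma> v1 \<in> carrier E" "\<sigma> v2 \<in> carrier E"
      "\<sigma> v \<in> carrier E"
      using closed[OF N(1), of u1] closed[OF N(1), of u2] closed[OF N(2), of v1] closed[OF N(2), of v2]
        closed[OF N(2), of v] u v uv by simp_all
    have prod_comm: "x \<otimes>\<^bsub>E\<^esub> (y \<otimes>\<^bsub>E\<^esub> z) = (y \<otimes>\<^bsub>E\<^esub> z) \<otimes>\<^bsub>E\<^esub> x"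
      if "x \<in> carrier E" "y \<in> carrier E" "z \<in> carrier E"
        "x \<otimes>\<^bsub>E\<^esub> y = y \<otimes>\<^bsub>E\<^esub> x" "x \<otimes>\<^bsub>E\<^esub> z = z \<otimes>\<^bsub>E\<^esub> x" for x y z
    proof -
      have "x \<otimes>\<^bsub>E\<^esub> (y \<otimes>\<^bsub>E\<^esub> z) = y \<otimes>\<^bsub>E\<^esub> x \<otimes>\<^bsub>E\<^esub> z" using that by (simp flip: E.m_assoc)
      also have "\<dots> = y \<otimes>\<^bsub>E\<^esub> (z \<otimes>\<^bsub>E\<^esub> x)" using that by (simp add: E.m_assoc)
      finally show ?thesis using that by (simp add: E.m_assoc)
    qed
    have "\<sigma> u1 \<otimes>\<^bsub>E\<^esub> \<sigma> v = \<sigma> v \<otimes>\<^bsub>E\<^esub> \<sigma> u1" using ecomm[OF N(2)] u uv by blast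
    moreover have "\<sigma> u2 \<otimes>\<^bsub>E\<^esub> \<sigma> v = \<sigma> v \<otimes>\<^bsub>E\<^esub> \<sigma> u2"
      using prod_comm[of "\<sigma> u2" "\<sigma> v1" "\<sigma> v2"] cl ecomm[OF N(1), of u2 v1] ecomm[OF N(3), of u2 v2] u v
        hom[OF N(2), of v1 v2] by simp
    ultimately show ?thesis
      using prod_comm[of "\<sigma> v" "\<sigma> u1" "\<sigma> u2"] cl hom[OF N(1), of u1 u2] u by simp
  qed
  have comm12: "u \<otimes> v = v \<otimes> u" if "u \<in> N1" "v \<in> N2" for u v
    using comm[OF NS[OF N(1) that(1)] NS[OF N(2) that(2)]] .
  have closed12: "\<sigma> s \<in> carrier E" if "s \<in> N1 \<union> N2" for s
    using that closed[OF N(1)] closed[OF N(2)] by blast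
  obtain \<tau> where \<tau>: "\<And>u v. \<lbrakk>u \<in> N1; v \<in> N2\<rbrakk> \<Longrightarrow> \<tau> (u \<otimes> v) = \<sigma> u \<otimes>\<^bsub>E\<^esub> \<sigma> v"
    and \<tau>_mult: "\<And>u v u' v'. \<lbrakk>u \<in> N1; v \<in> N2; u' \<in> N1; v' \<in> N2\<rbrakk> \<Longrightarrow>
      \<tau> ((u \<otimes> v) \<otimes> (u' \<otimes> v')) = \<tau> (u \<otimes> v) \<otimes>\<^bsub>E\<^esub> \<tau> (u' \<otimes> v')"
    using hom_extend_product[OF E sub(1)[OF N(1)] sub(1)[OF N(2)] comm12 hom[OF N(1)] hom[OF N(2)]
        closed12 N12] by blast
  have \<tau>_hom: "\<tau> (s \<otimes> t) = \<tau> s \<otimes>\<^bsub>E\<^esub> \<tau> t" if s: "s \<in> S" and t: "t \<in> S" for s t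
  proof -
    obtain u v where "u \<in> N1" "v \<in> N2" "s = u \<otimes> v" using product[OF s] by blast
    moreover obtain u' v' where "u' \<in> N1" "v' \<in> N2" "t = u' \<otimes> v'" using product[OF t] by blast
    ultimately show ?thesis using \<tau>_mult by simp
  qed
  have ones: "\<one> \<in> N1" "\<one> \<in> N2" using sub(1) N subgroup.one_closed by blast+
  have agree1: "\<tau> s = \<sigma> s" if "s \<in> N1" for s
    using \<tau>[OF that ones(2)] that closed[OF N(1)] NS[OF N(1)] SG by (simp add: one)
  have agree2: "\<tau> s = \<sigma> s" if "s \<in> N2" for s
    using \<tau>[OF ones(1) that] that closed[OF N(2)] NS[OF N(2)] SG by (simp add: one)
  \<comment> \<open>Agreement on M' and M'' passes to M through the factorization of M into its
    intersections with them.\<close>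
  have agree: "\<tau> s = \<sigma> s"
    if M: "M \<in> \<N>" "M' \<in> \<N>" "M'' \<in> \<N>" and c: "c \<in> M" "c \<in> M'" "c \<notin> M''"
      and t: "\<And>t. t \<in> M' \<Longrightarrow> \<tau> t = \<sigma> t" "\<And>t. t \<in> M'' \<Longrightarrow> \<tau> t = \<sigma> t" and s: "s \<in> M"
    for M M' M'' c s
  proof -
    obtain u v where uv: "u \<in> M" "u \<in> M'" "v \<in> M" "v \<in> M''" "s = u \<otimes> v"
      using factor[OF M c s] by blast
    then show ?thesis using \<tau>_hom hom[OF M(1)] t NS[OF M(1)] by simp
  qed
  \<comment> \<open>The \<open>N3\<close>-part v of \<open>a\<close> provides the witness needed for
    agreement on \<open>N3\<close>: it lies in \<open>N1\<close> and \<open>N3\<close> but not in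
    \<open>N2\<close>, since otherwise \<open>a\<close> would lie in \<open>N2\<close>.\<close>
  obtain u v where "u \<in> N2" "v \<in> N1" "v \<in> N3" "a = u \<otimes> v"
    using factor[OF N b a(1)] by blast
  moreover from this have "v \<notin> N2" using a(2) subgroup.m_closed[OF sub(1)[OF N(2)]] by blast
  ultimately have agree3: "\<tau> s = \<sigma> s" if "s \<in> N3" for s
    using agree[OF N(3,1,2)] agree1 agree2 that by blast
  have "\<tau> s = \<sigma> s" if M: "M \<in> \<N>" and s: "s \<in> M" for M s
  proof (cases "\<exists>c. c \<in> M \<and> c \<in> N1 \<and> (c \<notin> N2 \<or> c \<notin> N3)")
    case True
    then show ?thesis
      using agree[OF M N(1,2)] agree[OF M N(1,3)] agree1 agree2 agree3 s by blast
  next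
    \<comment> \<open>Here every element common to M and \<open>N1\<close> lies in \<open>N2\<close>
      and \<open>N3\<close>, which is impossible: b is outside M, so some a b^k lies in M and in
      \<open>N1\<close>, hence in \<open>N2\<close>, and this puts \<open>a\<close> into
      \<open>N2\<close>.\<close>
    case False
    then have "b \<notin> M" using b by blast
    then obtain k :: int where k: "a \<otimes> b [^] k \<in> M"
      using maximal[OF M, of b a] NS N a b by blast
    have bk: "b [^] k \<in> N1" "b [^] k \<in> N2" "b [^] k \<in> carrier G" "a \<in> carrier G"
      using subgroup_int_pow_closed sub(1) N a b NS SG by blast+
    then have "a \<otimes> b [^] k \<in> N1" using subgroup.m_closed[OF sub(1)[OF N(1)]] a by blast
    then have "a \<otimes> b [^] k \<in> N2" using False k by blast
    then have "a \<otimes> b [^] k \<otimes> inv (b [^] k) \<in> N2"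
      using bk subgroup.m_closed[OF sub(1)[OF N(2)]] subgroup.m_inv_closed[OF sub(1)[OF N(2)]] by blast
    then have "a \<in> N2" using bk by (simp add: m_assoc)
    then show ?thesis using a by blast
  qed
  then show thesis using that product \<tau>_hom by blast
qed

text \<open>The set \<open>K\<close> is the subgroup N <a>. It strictly contains N, and the index of
  N in S is prime, so Lagrange leaves only K = S.\<close>

lemma (in group) prime_index_maximal:
  assumes fin: "finite S" and S: "subgroup S G" and N: "subgroup N G" "N \<subseteq> S"
    and comm: "\<And>s t. \<lbrakk>s \<in> S; t \<in> S\<rbrakk> \<Longrightarrow> s \<otimes> t = t \<otimes> s"
    and p: "prime p" "card S = p * card N" and a: "a \<in> S" "a \<notin> N" and s: "s \<in> S"
  shows "\<exists>k::int. s \<otimes> a [^] k \<in> N"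
proof -
  have SG: "s \<in> carrier G" if "s \<in> S" for s using S that by (rule subgroup.mem_carrier)
  define K where "K = {s \<in> S. \<exists>k::int. s \<otimes> a [^] k \<in> N}"
  have ak: "a [^] k \<in> S" for k :: int using subgroup_int_pow_closed[OF S a(1)] .
  have K: "subgroup K G"
  proof (rule subgroupI)
    show "K \<subseteq> carrier G" using SG by (auto simp: K_def)
    have "\<one> \<otimes> a [^] (0::int) \<in> N" using subgroup.one_closed[OF N(1)] by simp
    then show "K \<noteq> {}" using subgroup.one_closed[OF S] unfolding K_def by blast
  next
    fix u assume "u \<in> K"
    then obtain k :: int where u: "u \<in> S" "u \<otimes> a [^] k \<in> N" by (auto simp: K_def)
    have "inv (u \<otimes> a [^] k) = inv u \<otimes> a [^] (- k)"
      using comm[of "inv u" "inv (a [^] k)"] u ak SG a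
      by (simp add: inv_mult_group subgroup.m_inv_closed[OF S] int_pow_neg)
    then have "inv u \<otimes> a [^] (- k) \<in> N" using subgroup.m_inv_closed[OF N(1) u(2)] by simp
    then show "inv u \<in> K" using subgroup.m_inv_closed[OF S u(1)] unfolding K_def by blast
  next
    fix u v assume "u \<in> K" "v \<in> K"
    then obtain k l :: int where u: "u \<in> S" "u \<otimes> a [^] k \<in> N" "v \<in> S" "v \<otimes> a [^] l \<in> N"
      by (auto simp: K_def)
    have "(u \<otimes> a [^] k) \<otimes> (v \<otimes> a [^] l) = u \<otimes> (a [^] k \<otimes> v) \<otimes> a [^] l"
      using u ak SG a by (simp add: m_assoc)
    also have "a [^] k \<otimes> v = v \<otimes> a [^] k" using comm u ak by simp
    also have "u \<otimes> (v \<otimes> a [^] k) \<otimes> a [^] l = (u \<otimes> v) \<otimes> a [^] (k + l)"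
      using u SG a by (simp add: m_assoc int_pow_mult)
    finally have "(u \<otimes> v) \<otimes> a [^] (k + l) \<in> N" using subgroup.m_closed[OF N(1) u(2,4)] by simp
    then show "u \<otimes> v \<in> K" using subgroup.m_closed[OF S u(1,3)] unfolding K_def by blast
  qed
  have NK: "N \<subseteq> K"
  proof
    fix u assume "u \<in> N"
    then have "u \<in> S" "u \<otimes> a [^] (0::int) \<in> N" using N SG by auto
    then show "u \<in> K" unfolding K_def by blast
  qed
  have "a \<otimes> a [^] (- 1 :: int) = \<one>" using SG a by (simp add: int_pow_neg)
  then have aK: "a \<in> K" using a subgroup.one_closed[OF N(1)] unfolding K_def by (intro CollectI conjI exI[of _ "- 1"]) simp_all
  have KS: "K \<subseteq> S" by (auto simp: K_def)
  obtain j where j: "card K = card N * j" using card_dvd_card_subgroup[OF N(1) K NK] by blast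
  have "card N \<noteq> 0"
    using subgroup.one_closed[OF N(1)] finite_subset[OF N(2) fin] by (auto simp: card_eq_0_iff)
  moreover have "card N * j dvd p * card N" using card_dvd_card_subgroup[OF K S KS] j p by simp
  ultimately have "j dvd p" by simp
  moreover have "j \<noteq> 1"
  proof
    assume "j = 1"
    then have "N = K" using j card_subset_eq[OF finite_subset[OF KS fin] NK] by simp
    then show False using a aK by blast
  qed
  ultimately have "j = p" using p(1) by (auto simp: prime_nat_iff)
  then have "K = S" using card_subset_eq[OF fin KS] j p(2) by (simp add: mult.commute)
  then show ?thesis using s unfolding K_def by blast
qed


section \<open>Splitting over an abelian subgroup\<close>

context twisted_cocycle
begin

text \<open>\<open>w\<close> is the coboundary of \<open>B\<close>, so its own coboundary vanishes.
  As \<open>w\<close> does not depend on the point, the relation for (h, k) may be read at g and the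
  others at \<one>, where all values of \<open>B\<close> cancel.\<close>

lemma w_cocycle:
  assumes "g \<in> carrier G" "h \<in> carrier G" "k \<in> carrier G"
  shows "w g h + w (g \<otimes> h) k = w h k + w g (h \<otimes> k)"
proof -
  have "w g h = B h g - B (g \<otimes> h) \<one> + B g \<one>" "w (g \<otimes> h) k = B k (g \<otimes> h) - B (g \<otimes> h \<otimes> k) \<one> + B (g \<otimes> h) \<one>"
    "w h k = B k (g \<otimes> h) - B (h \<otimes> k) g + B h g" "w g (h \<otimes> k) = B (h \<otimes> k) g - B (g \<otimes> (h \<otimes> k)) \<one> + B g \<one>"
    using B_cocycle[of g h \<one>] B_cocycle[of "g \<otimes> h" k \<one>] B_cocycle[of h k g] B_cocycle[of g "h \<otimes> k" \<one>]
      assms by simp_all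
  then show ?thesis using assms by (simp add: m_assoc)
qed

text \<open>On the orbit \<open>H r S\<close> the exact cocycle \<open>B - L\<close> vanishes on the stabilizer of \<open>H r\<close>, so that
  \<open>\<phi> (h r s) = (B - L) s r\<close> is well defined.\<close>

lemma splits_on_of_stabilizers:
  assumes S: "subgroup S G"
    and L_mult: "\<And>s t. \<lbrakk>s \<in> S; t \<in> S\<rbrakk> \<Longrightarrow> L (s \<otimes> t) = L s + L t - w s t"
    and L_stab: "\<And>s x. \<lbrakk>s \<in> S; x \<in> carrier G; x \<otimes> s \<otimes> inv x \<in> H\<rbrakk> \<Longrightarrow> L s = B s x"
  shows "splits_on G H S B"
proof -
  have SG: "s \<in> carrier G" if "s \<in> S" for s using S that by (rule subgroup.mem_carrier)
  have HG: "h \<in> carrier G" if "h \<in> H" for h using H_subgroup that by (rule subgroup.mem_carrier)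
  note cl = subgroup.m_closed[OF S] subgroup.m_inv_closed[OF S] subgroup.one_closed[OF S]
    subgroup.m_closed[OF H_subgroup] subgroup.m_inv_closed[OF H_subgroup] subgroup.one_closed[OF H_subgroup]
  define A where "A s x = B s x - L s" for s x
  have A_mult: "A (s \<otimes> t) x = A t (x \<otimes> s) + A s x" if "s \<in> S" "t \<in> S" "x \<in> carrier G" for s t x
    using that SG by (simp add: A_def B_mult L_mult)
  have A_inv: "A s (h \<otimes> x) = A s x" if "h \<in> H" "s \<in> S" "x \<in> carrier G" for h s x
    using that SG by (simp add: A_def B_inv)
  \<comment> \<open>The orbit of the coset H x under \<open>S\<close> is the double coset H x S;
    \<open>r\<close> will choose one element from each, depending only on the double coset as a
    set.\<close>
  define DC where "DC x = {h \<otimes> x \<otimes> s |h s. h \<in> H \<and> s \<in> S}" for x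
  have DC_sub: "DC (h \<otimes> x \<otimes> s) \<subseteq> DC x" if "h \<in> H" "s \<in> S" "x \<in> carrier G" for h s x
  proof
    fix y assume "y \<in> DC (h \<otimes> x \<otimes> s)"
    then obtain h' s' where y: "h' \<in> H" "s' \<in> S" "y = h' \<otimes> (h \<otimes> x \<otimes> s) \<otimes> s'" by (auto simp: DC_def)
    then have "y = (h' \<otimes> h) \<otimes> x \<otimes> (s \<otimes> s')" using that SG HG by (simp add: m_assoc)
    then show "y \<in> DC x" unfolding DC_def using y that cl by blast
  qed
  have DC_eq: "DC (h \<otimes> x \<otimes> s) = DC x" if "h \<in> H" "s \<in> S" "x \<in> carrier G" for h s x
  proof (rule equalityI[OF DC_sub[OF that]])
    have "inv h \<otimes> (h \<otimes> x \<otimes> s) \<otimes> inv s = x"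
      using that SG HG by (simp add: m_assoc) (simp flip: m_assoc)
    then show "DC x \<subseteq> DC (h \<otimes> x \<otimes> s)"
      using DC_sub[of "inv h" "inv s" "h \<otimes> x \<otimes> s"] that cl SG HG by simp
  qed
  define r where "r x = (SOME y. y \<in> DC x)" for x
  have r_in: "r x \<in> DC x" if "x \<in> carrier G" for x
  proof -
    have "\<one> \<otimes> x \<otimes> \<one> \<in> DC x" unfolding DC_def using cl by blast
    then show ?thesis unfolding r_def by (rule someI)
  qed
  \<comment> \<open>\<sigma> is chosen through the predicate \<open>P x\<close> rather than together
    with h: \<open>P_H\<close> shows that this predicate depends only on the coset H x, and
    therefore so does the choice.\<close>
  define P where "P x s \<longleftrightarrow> s \<in> S \<and> (\<exists>h\<in>H. h \<otimes> x = r x \<otimes> s)" for x s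
  define \<sigma> where "\<sigma> x = (SOME s. P x s)" for x
  have r_closed: "r x \<in> carrier G" if "x \<in> carrier G" for x
    using r_in[OF that] SG HG that by (auto simp: DC_def)
  have P: "P x (\<sigma> x)" if x: "x \<in> carrier G" for x
  proof -
    obtain h s where hs: "h \<in> H" "s \<in> S" "r x = h \<otimes> x \<otimes> s" using r_in[OF x] by (auto simp: DC_def)
    then have "h \<otimes> x = r x \<otimes> inv s" using x SG HG by (simp add: m_assoc)
    then have "P x (inv s)" using hs cl unfolding P_def by blast
    then show ?thesis unfolding \<sigma>_def by (rule someI)
  qed
  have r_H: "r (h \<otimes> x) = r x" if "h \<in> H" "x \<in> carrier G" for h x
    using DC_eq[OF that(1) cl(3) that(2)] that HG by (simp add: r_def)
  have r_S: "r (x \<otimes> s) = r x" if "s \<in> S" "x \<in> carrier G" for s x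
    using DC_eq[OF cl(6) that] that by (simp add: r_def)
  have P_sub: "P x s" if Phx: "P (h \<otimes> x) s" and hx: "h \<in> H" "x \<in> carrier G" for h x s
  proof -
    obtain h' where "h' \<in> H" "h' \<otimes> (h \<otimes> x) = r x \<otimes> s"
      using Phx unfolding P_def r_H[OF hx] by blast
    then have "h' \<otimes> h \<in> H" "(h' \<otimes> h) \<otimes> x = r x \<otimes> s" using hx HG cl by (auto simp: m_assoc)
    then show ?thesis using Phx unfolding P_def by blast
  qed
  have P_H: "P (h \<otimes> x) = P x" if "h \<in> H" "x \<in> carrier G" for h x
  proof (intro ext iffI)
    fix s assume "P x s"
    moreover have "inv h \<otimes> (h \<otimes> x) = x" using that HG by (simp flip: m_assoc)
    ultimately show "P (h \<otimes> x) s" using P_sub[of "inv h" "h \<otimes> x" s] that HG cl by simp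
  qed (use P_sub that in blast)
  define \<phi> where "\<phi> x = A (\<sigma> x) (r x)" for x
  show ?thesis
  proof (rule splits_onI[where \<phi> = \<phi> and \<mu> = L])
    fix h x assume "h \<in> H" "x \<in> carrier G"
    then show "\<phi> (h \<otimes> x) = \<phi> x" by (simp add: \<phi>_def \<sigma>_def r_H P_H)
  next
    fix s x assume s: "s \<in> S" and x: "x \<in> carrier G"
    obtain h where h: "h \<in> H" "h \<otimes> x = r x \<otimes> \<sigma> x" and \<sigma>: "\<sigma> x \<in> S" using P[OF x] by (auto simp: P_def)
    obtain h' where h': "h' \<in> H" "h' \<otimes> (x \<otimes> s) = r x \<otimes> \<sigma> (x \<otimes> s)" and \<sigma>': "\<sigma> (x \<otimes> s) \<in> S"
      using P[of "x \<otimes> s"] x s SG r_S by (auto simp: P_def)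
    \<comment> \<open>\<open>n\<close> compares two ways from the representative to x s, by \<sigma>
      (x s) and by \<sigma> x followed by s. It stabilizes the coset of \<open>r x\<close>, so
      \<open>A n\<close> vanishes there and both ways give the same value.\<close>
    define n where "n = \<sigma> (x \<otimes> s) \<otimes> inv (\<sigma> x \<otimes> s)"
    have n: "n \<in> S" "n \<otimes> (\<sigma> x \<otimes> s) = \<sigma> (x \<otimes> s)" using \<sigma> \<sigma>' s cl SG by (auto simp: n_def m_assoc)
    have "r x \<otimes> n = (h' \<otimes> (x \<otimes> s)) \<otimes> inv (\<sigma> x \<otimes> s)"
      using \<sigma> \<sigma>' s SG x r_closed by (simp add: n_def h' flip: m_assoc)
    also have "\<dots> = h' \<otimes> (x \<otimes> inv (\<sigma> x))"
      using \<sigma> s SG HG h'(1) x by (simp add: inv_mult_group m_assoc mult_inv_cancel_left)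
    also have "x \<otimes> inv (\<sigma> x) = inv h \<otimes> (h \<otimes> x \<otimes> inv (\<sigma> x))"
      using h(1) x HG \<sigma> SG by (simp add: m_assoc mult_inv_cancel_left)
    also have "h' \<otimes> (inv h \<otimes> (h \<otimes> x \<otimes> inv (\<sigma> x))) = (h' \<otimes> inv h) \<otimes> r x"
      unfolding h(2) using h(1) h'(1) HG \<sigma> SG r_closed[OF x] by (simp add: m_assoc)
    finally have rn: "r x \<otimes> n = (h' \<otimes> inv h) \<otimes> r x" .
    then have "r x \<otimes> n \<otimes> inv (r x) \<in> H"
      using h h' cl HG r_closed[OF x] by (simp add: m_assoc)
    then have "A n (r x) = 0" using L_stab[OF n(1) r_closed[OF x]] by (simp add: A_def)
    then have "A (\<sigma> (x \<otimes> s)) (r x) = A (\<sigma> x \<otimes> s) (r x \<otimes> n)"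
      using A_mult[of n "\<sigma> x \<otimes> s" "r x"] n \<sigma> s cl r_closed[OF x] by simp
    also have "\<dots> = A (\<sigma> x \<otimes> s) (r x)"
      unfolding rn using h h' \<sigma> s cl r_closed[OF x] by (intro A_inv) auto
    also have "\<dots> = A s (h \<otimes> x) + A (\<sigma> x) (r x)" using \<sigma> s r_closed[OF x] by (simp add: A_mult h)
    finally have "\<phi> (x \<otimes> s) = A s x + \<phi> x" using A_inv[OF h(1) s x] by (simp add: \<phi>_def r_S s x)
    then show "B s x = \<phi> (x \<otimes> s) - \<phi> x + L s" by (simp add: A_def)
  qed
qed

text \<open>The assumptions \<open>index\<close> and \<open>core\<close> are the form in which a
  faithful action with orbits of length p enters: the stabilizers in S of cosets H x have index p
  and intersect trivially. For one element s, \<open>cyc\<close> provides a single constant \<mu> s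
  valid at all points.\<close>

lemma splits_on_abelian:
  assumes S: "subgroup S G" and fin: "finite S"
    and comm: "\<And>s t. \<lbrakk>s \<in> S; t \<in> S\<rbrakk> \<Longrightarrow> s \<otimes> t = t \<otimes> s"
    and p: "prime p" "card S = p ^ m" "m \<ge> 3"
    and index: "\<And>x. x \<in> carrier G \<Longrightarrow> card S = p * card {s \<in> S. x \<otimes> s \<otimes> inv x \<in> H}"
    and core: "\<And>s. \<lbrakk>s \<in> S; \<And>x. x \<in> carrier G \<Longrightarrow> x \<otimes> s \<otimes> inv x \<in> H\<rbrakk> \<Longrightarrow> s = \<one>"
    and cyc: "\<And>s. s \<in> S \<Longrightarrow> splits_on G H {s} B"
  shows "splits_on G H S B"
proof -
  have SG: "s \<in> carrier G" if "s \<in> S" for s using S that by (rule subgroup.mem_carrier)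
  define N where "N x = {s \<in> S. x \<otimes> s \<otimes> inv x \<in> H}" for x
  have NS: "N x \<subseteq> S" for x by (auto simp: N_def)
  have N_sub: "subgroup (N x) G" if x: "x \<in> carrier G" for x
  proof (rule subgroupI)
    show "N x \<subseteq> carrier G" using SG by (auto simp: N_def)
    have "\<one> \<in> N x" using x subgroup.one_closed[OF S] subgroup.one_closed[OF H_subgroup] by (simp add: N_def)
    then show "N x \<noteq> {}" by blast
  next
    fix s assume "s \<in> N x"
    then have s: "s \<in> S" "x \<otimes> s \<otimes> inv x \<in> H" by (auto simp: N_def)
    have "x \<otimes> inv s \<otimes> inv x = inv (x \<otimes> s \<otimes> inv x)"
      using x s SG by (simp add: inv_mult_group m_assoc)
    then show "inv s \<in> N x"
      using s subgroup.m_inv_closed[OF S] subgroup.m_inv_closed[OF H_subgroup] by (simp add: N_def)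
  next
    fix s t assume "s \<in> N x" "t \<in> N x"
    then have s: "s \<in> S" "x \<otimes> s \<otimes> inv x \<in> H" "t \<in> S" "x \<otimes> t \<otimes> inv x \<in> H" by (auto simp: N_def)
    have "inv x \<otimes> (x \<otimes> (t \<otimes> inv x)) = t \<otimes> inv x" using x s SG by (simp flip: m_assoc)
    then have "x \<otimes> (s \<otimes> t) \<otimes> inv x = (x \<otimes> s \<otimes> inv x) \<otimes> (x \<otimes> t \<otimes> inv x)"
      using x s SG by (simp add: m_assoc)
    then show "s \<otimes> t \<in> N x"
      using s subgroup.m_closed[OF S] subgroup.m_closed[OF H_subgroup] by (simp add: N_def)
  qed
  have fixed: "B t (x \<otimes> s) = B t x" if "x \<in> carrier G" "s \<in> N x" "t \<in> carrier G" for t s x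
  proof -
    have "x \<otimes> s = (x \<otimes> s \<otimes> inv x) \<otimes> x" using that SG by (simp add: N_def m_assoc)
    then show ?thesis using B_inv[of "x \<otimes> s \<otimes> inv x" t x] that by (simp add: N_def)
  qed
  \<comment> \<open>At a point fixed by s the coboundary part of \<open>B s\<close> vanishes, and
    only the constant \<mu> s remains.\<close>
  have indep: "B s x = B s y" if "x \<in> carrier G" "y \<in> carrier G" "s \<in> N x" "s \<in> N y" for s x y
  proof -
    obtain \<phi> \<mu> where \<phi>: "\<And>h x. \<lbrakk>h \<in> H; x \<in> carrier G\<rbrakk> \<Longrightarrow> \<phi> (h \<otimes> x) = \<phi> x"
      and \<mu>: "\<And>x. x \<in> carrier G \<Longrightarrow> B s x = \<phi> (x \<otimes> s) - \<phi> x + \<mu> s"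
    proof -
      have "splits_on G H {s} B" using cyc \<open>s \<in> N x\<close> by (simp add: N_def)
      then show thesis by (rule splits_onE) (rule that, auto)
    qed
    have "B s z = \<mu> s" if "z \<in> carrier G" "s \<in> N z" for z
    proof -
      have "z \<otimes> s = (z \<otimes> s \<otimes> inv z) \<otimes> z" using that SG by (simp add: N_def m_assoc)
      then have "\<phi> (z \<otimes> s) = \<phi> z" using \<phi>[of "z \<otimes> s \<otimes> inv z" z] that by (simp add: N_def)
      then show ?thesis using \<mu>[OF that(1)] by simp
    qed
    then show ?thesis using that by metis
  qed
  define L where "L s = B s (SOME x. x \<in> carrier G \<and> s \<in> N x)" for s
  have L: "L s = B s x" if "x \<in> carrier G" "s \<in> N x" for s x
  proof -
    have "(SOME x. x \<in> carrier G \<and> s \<in> N x) \<in> carrier G \<and> s \<in> N (SOME x. x \<in> carrier G \<and> s \<in> N x)"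
      by (rule someI[of _ x]) (use that in blast)
    then show ?thesis using indep that unfolding L_def by blast
  qed
  have L_mult: "L (s \<otimes> t) = L s + L t - w s t" if "x \<in> carrier G" "s \<in> N x" "t \<in> N x" for x s t
  proof -
    have "s \<otimes> t \<in> N x" using subgroup.m_closed[OF N_sub] that by blast
    then have "L (s \<otimes> t) = B (s \<otimes> t) x" using that(1) by (intro L)
    moreover have "s \<in> carrier G" "t \<in> carrier G" using that NS SG by blast+
    ultimately show ?thesis using that fixed[of x s t] L[of x s] L[of x t] B_mult[of s t x] by simp
  qed
  \<comment> \<open>\<open>E\<close> is the extension of S by the coefficients with cocycle -w, so
    that \<open>L_mult\<close> says exactly that s \<mapsto> (s, L s) is multiplicative on each
    \<open>N x\<close>. The cocycle is not normalized, which is why the unit carries the entry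
    \<open>w \<one> \<one>\<close>.\<close>
  define E where "E = \<lparr>carrier = S \<times> (UNIV :: 'a set), monoid.mult = (\<lambda>(s, a) (t, b). (s \<otimes> t, a + b - w s t)),
    one = (\<one>, w \<one> \<one>)\<rparr>"
  have w_one: "w \<one> t = w \<one> \<one>" if "t \<in> S" for t
    using w_cocycle[of \<one> \<one> t] that SG by simp
  have E: "group E"
  proof (rule groupI)
    fix x y z assume "x \<in> carrier E" "y \<in> carrier E" "z \<in> carrier E"
    moreover obtain s a t b u c where "x = (s, a)" "y = (t, b)" "z = (u, c)" by (metis surj_pair)
    ultimately show "x \<otimes>\<^bsub>E\<^esub> y \<otimes>\<^bsub>E\<^esub> z = x \<otimes>\<^bsub>E\<^esub> (y \<otimes>\<^bsub>E\<^esub> z)"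
      using w_cocycle[of s t u] SG by (auto simp: E_def m_assoc algebra_simps)
  next
    fix x assume "x \<in> carrier E"
    then obtain s a where x: "x = (s, a)" "s \<in> S" by (auto simp: E_def)
    show "\<one>\<^bsub>E\<^esub> \<otimes>\<^bsub>E\<^esub> x = x" using x SG w_one by (simp add: E_def)
    show "\<exists>y\<in>carrier E. y \<otimes>\<^bsub>E\<^esub> x = \<one>\<^bsub>E\<^esub>"
      using x SG subgroup.m_inv_closed[OF S]
      by (intro bexI[of _ "(inv s, w \<one> \<one> + w (inv s) s - a)"]) (auto simp: E_def)
  qed (auto simp: E_def subgroup.m_closed[OF S] subgroup.one_closed[OF S])
  have card_gt: "\<exists>s\<in>X. s \<noteq> \<one>" if "card X > 1" for X
  proof (rule ccontr)
    assume "\<not> ?thesis"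
    then have "card X \<le> card {\<one>}" by (intro card_mono) auto
    then show False using that by simp
  qed
  have cardN: "card (N x) = p ^ (m - 1)" if "x \<in> carrier G" for x
  proof -
    have "p * p ^ (m - 1) = p * card (N x)"
      using index[OF that] p by (simp add: N_def flip: power_Suc)
    then show ?thesis using p(1) by (simp add: prime_gt_0_nat)
  qed
  have p1: "p > 1" using p(1) by (rule prime_gt_1_nat)
  have "card (N \<one>) > 1" using cardN[OF one_closed] p(3) one_less_power[OF p1, of "m - 1"] by simp
  then obtain a where a: "a \<in> N \<one>" "a \<noteq> \<one>" using card_gt by blast
  then obtain x where x: "x \<in> carrier G" "a \<notin> N x" using core[of a] by (auto simp: N_def)
  \<comment> \<open>If the two stabilizers met trivially, their product set would have p^(2 (m - 1))
    elements inside S of order p^m. This is where m \<ge> 3 enters.\<close>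
  have "\<exists>b. b \<in> N \<one> \<and> b \<in> N x \<and> b \<noteq> \<one>"
  proof (rule ccontr)
    assume "\<not> ?thesis"
    then have triv: "b = \<one>" if "b \<in> N \<one>" "b \<in> N x" for b using that by blast
    have "inj_on (\<lambda>(u, v). u \<otimes> v) (N \<one> \<times> N x)"
    proof (rule inj_onI, clarify)
      fix u v u' v' assume uv: "u \<in> N \<one>" "v \<in> N x" "u' \<in> N \<one>" "v' \<in> N x" "u \<otimes> v = u' \<otimes> v'"
      have cl: "u \<in> carrier G" "v \<in> carrier G" "u' \<in> carrier G" "v' \<in> carrier G" using uv NS SG by blast+
      have "inv u' \<otimes> u = inv u' \<otimes> (u \<otimes> v) \<otimes> inv v" using cl by (simp add: m_assoc)
      also have "\<dots> = v' \<otimes> inv v" using cl by (simp add: uv(5) m_assoc mult_inv_cancel_left)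
      finally have eq: "inv u' \<otimes> u = v' \<otimes> inv v" .
      moreover have "inv u' \<otimes> u \<in> N \<one>" "v' \<otimes> inv v \<in> N x"
        using uv N_sub x by (auto intro!: subgroup.m_closed subgroup.m_inv_closed)
      ultimately have "inv u' \<otimes> u = \<one>" "v' \<otimes> inv v = \<one>" using triv by metis+
      then show "u = u' \<and> v = v'" using cl by (metis inv_equality inv_inv inv_closed)
    qed
    moreover have "(\<lambda>(u, v). u \<otimes> v) ` (N \<one> \<times> N x) \<subseteq> S"
      using NS subgroup.m_closed[OF S] by fastforce
    ultimately have "card (N \<one> \<times> N x) \<le> card S" using fin by (rule card_inj_on_le)
    then have "p ^ (m - 1 + (m - 1)) \<le> p ^ m"
      by (simp only: card_cartesian_product cardN[OF x(1)] cardN[OF one_closed] p(2) power_add)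
    then have "m - 1 + (m - 1) \<le> m" using p1 by (metis power_le_imp_le_exp)
    then show False using p(3) by simp
  qed
  then obtain b where b: "b \<in> N \<one>" "b \<in> N x" "b \<noteq> \<one>" by blast
  then obtain y where y: "y \<in> carrier G" "b \<notin> N y" using core[of b] by (auto simp: N_def)
  obtain \<tau> where prod: "\<And>s. s \<in> S \<Longrightarrow> \<exists>u\<in>N \<one>. \<exists>v\<in>N x. s = u \<otimes> v"
    and hom: "\<And>s t. \<lbrakk>s \<in> S; t \<in> S\<rbrakk> \<Longrightarrow> \<tau> (s \<otimes> t) = \<tau> s \<otimes>\<^bsub>E\<^esub> \<tau> t"
    and agree: "\<And>M s. \<lbrakk>M \<in> N ` carrier G; s \<in> M\<rbrakk> \<Longrightarrow> \<tau> s = (s, L s)"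
  proof (rule hom_amalgam_maximal[OF E S comm, of "N ` carrier G" "\<lambda>s. (s, L s)" "N \<one>" "N x" "N y" a b])
    fix M assume "M \<in> N ` carrier G"
    then show "subgroup M G" "M \<subseteq> S" using N_sub NS by auto
  next
    fix M c s assume *: "M \<in> N ` carrier G" "c \<in> S" "c \<notin> M" "s \<in> S"
    then obtain z where z: "z \<in> carrier G" "M = N z" by blast
    then show "\<exists>k::int. s \<otimes> c [^] k \<in> M"
      using prime_index_maximal[OF fin S N_sub NS comm p(1)] index[OF z(1)] * unfolding N_def by blast
  next
    fix M s t assume "M \<in> N ` carrier G" "s \<in> M" "t \<in> M"
    then show "(s \<otimes> t, L (s \<otimes> t)) = (s, L s) \<otimes>\<^bsub>E\<^esub> (t, L t)" by (auto simp: E_def L_mult)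
  next
    fix M s assume "M \<in> N ` carrier G" "s \<in> M"
    then show "(s, L s) \<in> carrier E" using NS by (auto simp: E_def)
  qed (use a b x y in auto)
  have agree': "\<tau> s = (s, L s)" if "z \<in> carrier G" "s \<in> N z" for z s using agree that by blast
  \<comment> \<open>The glued map is a section of the projection from \<open>E\<close> to S: it is
    one on both factors of every s = u v. Its second component is the required splitting
    constant.\<close>
  have \<tau>: "\<tau> s = (s, snd (\<tau> s))" if "s \<in> S" for s
  proof -
    obtain u v where uv: "u \<in> N \<one>" "v \<in> N x" "s = u \<otimes> v" using prod[OF \<open>s \<in> S\<close>] by blast
    then have "\<tau> s = (u, L u) \<otimes>\<^bsub>E\<^esub> (v, L v)" 
      using hom[of u v] agree'[OF one_closed, of u] agree'[OF x(1), of v] subsetD[OF NS] by simp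
    then show ?thesis by (simp add: E_def uv)
  qed
  show ?thesis
  proof (rule splits_on_of_stabilizers[OF S, of "\<lambda>s. snd (\<tau> s)"])
    fix s t assume "s \<in> S" "t \<in> S"
    then have "\<tau> (s \<otimes> t) = (s, snd (\<tau> s)) \<otimes>\<^bsub>E\<^esub> (t, snd (\<tau> t))" using hom \<tau> by metis
    then show "snd (\<tau> (s \<otimes> t)) = snd (\<tau> s) + snd (\<tau> t) - w s t" by (simp add: E_def)
  next
    fix s z assume "s \<in> S" "z \<in> carrier G" "z \<otimes> s \<otimes> inv z \<in> H"
    then show "snd (\<tau> s) = B s z" using agree'[of z s] L[of z s] by (simp add: N_def)
  qed
qed

end


section \<open>Integral lifts of cocycles\<close>

definition H_invariant :: "('g, 'x) monoid_scheme \<Rightarrow> 'g set \<Rightarrow> ('g \<Rightarrow> 'b) \<Rightarrow> bool"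
  where "H_invariant G H f \<longleftrightarrow> (\<forall>h\<in>H. \<forall>x\<in>carrier G. f (h \<otimes>\<^bsub>G\<^esub> x) = f x)"

text \<open>The representative is cut down to the carrier here, so that lifts may be arbitrary
  functions on the type and pointwise formulas can be written without
  \<open>restrict\<close>.\<close>

definition J_class :: "('g, 'x) monoid_scheme \<Rightarrow> 'g set \<Rightarrow> ('g \<Rightarrow> int) \<Rightarrow> ('g \<Rightarrow> int) set"
  where "J_class G H f = (const_map G ` carrier integer_group) #>\<^bsub>Ind_int G H\<^esub> restrict f (carrier G)"

text \<open>For an integral lift \<open>F\<close> of a cochain of degree two with values in J, this
  expresses that the cochain is a coboundary over \<open>D\<close>; the constants
  \<open>z s t\<close> disappear in J.\<close>

definition int_splits_on ::
    "('g, 'x) monoid_scheme \<Rightarrow> 'g set \<Rightarrow> 'g set \<Rightarrow> ('g \<Rightarrow> 'g \<Rightarrow> 'g \<Rightarrow> int) \<Rightarrow> bool"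
  where "int_splits_on G H D F \<longleftrightarrow> (\<exists>b z. (\<forall>s\<in>D. H_invariant G H (b s)) \<and>
    (\<forall>s\<in>D. \<forall>t\<in>D. \<forall>x\<in>carrier G.
      F s t x = b t (x \<otimes>\<^bsub>G\<^esub> s) - b (s \<otimes>\<^bsub>G\<^esub> t) x + b s x + z s t))"

section \<open>The module J through integral representatives\<close>

locale induced_module = group G for G :: "('g, 'x) monoid_scheme" (structure) +
  fixes H :: "'g set"
  assumes H_subgroup: "subgroup H G"
begin

abbreviation "J \<equiv> J_mod G H"
abbreviation "jc \<equiv> J_class G H"

lemma H_closed: "h \<in> H \<Longrightarrow> h \<in> carrier G"
  using H_subgroup by (rule subgroup.mem_carrier)

lemma Ind_carrier: "f \<in> carrier (Ind_int G H) \<longleftrightarrow> f \<in> extensional (carrier G) \<and> H_invariant G H f"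
  by (auto simp: Ind_def H_invariant_def PiE_iff)

lemma H_invariant_restrict: "H_invariant G H (restrict f (carrier G)) \<longleftrightarrow> H_invariant G H f"
  using H_closed by (auto simp: H_invariant_def)

lemma restrict_Ind: "H_invariant G H f \<Longrightarrow> restrict f (carrier G) \<in> carrier (Ind_int G H)"
  by (simp add: Ind_carrier H_invariant_restrict)

lemma group_module_J_mod: "group_module G J (J_act G)"
  by (rule group_module_J(1)[OF is_group H_subgroup])

interpretation group_module G J "J_act G"
  by (rule group_module_J_mod)

lemma comm_group_Ind: "comm_group (Ind_int G H)"
proof -
  let ?P = "product_group (carrier G) (\<lambda>_. integer_group)"
  interpret P: group ?P by simp
  have "subgroup (carrier (Ind_int G H)) ?P"
    by (rule P.subgroupI)
      (auto simp: Ind_def H_closed PiE_iff extensional_def split: if_splits intro!: exI[of _ "\<lambda>x\<in>carrier G. 0"])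
  then have "group (?P\<lparr>carrier := carrier (Ind_int G H)\<rparr>)" by (rule P.subgroup_imp_group)
  then have "group (Ind_int G H)" by (simp add: Ind_def)
  then show ?thesis
    by (rule group.group_comm_groupI) (auto simp: Ind_def add.commute)
qed

lemma normal_consts: "const_map G ` carrier integer_group \<lhd> Ind_int G H"
  using comm_group.subgroup_imp_normal[OF comm_group_Ind] group_module_J(2)[OF is_group H_subgroup] by blast

lemma Ind_mult: "f \<otimes>\<^bsub>Ind_int G H\<^esub> f' = (\<lambda>x\<in>carrier G. f x + f' x)"
  by (simp add: Ind_def)

lemma J_class_closed: "H_invariant G H f \<Longrightarrow> jc f \<in> carrier J"
  by (auto simp: J_mod_def FactGroup_def RCOSETS_def J_class_def intro!: restrict_Ind)

definition J_lift :: "('g \<Rightarrow> int) set \<Rightarrow> 'g \<Rightarrow> int"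
  where "J_lift C = (SOME f. H_invariant G H f \<and> C = jc f)"

lemma J_lift:
  assumes "C \<in> carrier J"
  shows "H_invariant G H (J_lift C)" "jc (J_lift C) = C"
proof -
  obtain f where f: "f \<in> carrier (Ind_int G H)" "C = (const_map G ` carrier integer_group) #>\<^bsub>Ind_int G H\<^esub> f"
    using assms by (auto simp: J_mod_def FactGroup_def RCOSETS_def)
  then have "H_invariant G H f \<and> C = jc f" by (simp add: J_class_def Ind_carrier extensional_restrict)
  from someI[of "\<lambda>f. H_invariant G H f \<and> C = jc f", OF this]
  show "H_invariant G H (J_lift C)" "jc (J_lift C) = C" by (simp_all add: J_lift_def)
qed

lemma J_class_mult:
  assumes "H_invariant G H f" "H_invariant G H f'"
  shows "jc f \<otimes>\<^bsub>J\<^esub> jc f' = jc (\<lambda>x. f x + f' x)"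
proof -
  have "restrict f (carrier G) \<otimes>\<^bsub>Ind_int G H\<^esub> restrict f' (carrier G) = restrict (\<lambda>x. f x + f' x) (carrier G)"
    by (auto simp: Ind_mult)
  then show ?thesis
    using normal.rcos_sum[OF normal_consts restrict_Ind[OF assms(1)] restrict_Ind[OF assms(2)]]
    by (simp add: J_class_def J_mod_def FactGroup_def)
qed

lemma J_class_eq_iff:
  assumes "H_invariant G H f" "H_invariant G H f'"
  shows "jc f = jc f' \<longleftrightarrow> (\<exists>z. \<forall>x\<in>carrier G. f x = f' x + z)"
proof
  assume "jc f = jc f'"
  moreover have "restrict f (carrier G) \<in> jc f"
    unfolding J_class_def
    by (rule group.rcos_self[OF comm_group.axioms(2)[OF comm_group_Ind] restrict_Ind[OF assms(1)]])
      (rule group_module_J(2)[OF is_group H_subgroup])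
  ultimately obtain z where z: "restrict f (carrier G) = const_map G z \<otimes>\<^bsub>Ind_int G H\<^esub> restrict f' (carrier G)"
    by (auto simp: J_class_def r_coset_def)
  have "f x = f' x + z" if "x \<in> carrier G" for x
    using fun_cong[OF z, of x] that by (simp add: Ind_mult const_map_def)
  then show "\<exists>z. \<forall>x\<in>carrier G. f x = f' x + z" by blast
next
  assume "\<exists>z. \<forall>x\<in>carrier G. f x = f' x + z"
  then obtain z where z: "\<forall>x\<in>carrier G. f x = f' x + z" by blast
  have "restrict f (carrier G) = const_map G z \<otimes>\<^bsub>Ind_int G H\<^esub> restrict f' (carrier G)"
    using z by (auto simp: Ind_mult const_map_def intro!: ext)
  then have "restrict f (carrier G) \<in> jc f'" by (auto simp: J_class_def r_coset_def)
  then show "jc f = jc f'"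
    using group.repr_independence[OF comm_group.axioms(2)[OF comm_group_Ind] _ restrict_Ind[OF assms(2)]
        group_module_J(2)[OF is_group H_subgroup]]
    unfolding J_class_def by simp
qed

lemma J_one: "\<one>\<^bsub>J\<^esub> = jc (\<lambda>_. 0)"
proof -
  have inv: "H_invariant G H (\<lambda>_. 0 :: int)" by (simp add: H_invariant_def)
  have "jc (\<lambda>_. 0) \<otimes>\<^bsub>J\<^esub> jc (\<lambda>_. 0) = jc (\<lambda>_. 0)" using J_class_mult[OF inv inv] by simp
  then show ?thesis using M.r_cancel_one J_class_closed[OF inv] by metis
qed

lemma J_class_inv:
  assumes "H_invariant G H f"
  shows "inv\<^bsub>J\<^esub> jc f = jc (\<lambda>x. - f x)"
proof (rule M.inv_equality)
  have inv: "H_invariant G H (\<lambda>x. - f x)" using assms by (simp add: H_invariant_def)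
  show "jc (\<lambda>x. - f x) \<otimes>\<^bsub>J\<^esub> jc f = \<one>\<^bsub>J\<^esub>" using J_class_mult[OF inv assms] by (simp add: J_one)
  show "jc f \<in> carrier J" "jc (\<lambda>x. - f x) \<in> carrier J" using assms inv by (simp_all add: J_class_closed)
qed

lemma J_class_act:
  assumes "g \<in> carrier G"
  shows "J_act G g (jc f) = jc (\<lambda>x. f (x \<otimes> g))"
proof -
  have "Ind_act G g (const_map G z \<otimes>\<^bsub>Ind_int G H\<^esub> restrict f (carrier G)) =
      const_map G z \<otimes>\<^bsub>Ind_int G H\<^esub> restrict (\<lambda>x. f (x \<otimes> g)) (carrier G)" for z
    using assms by (auto simp: Ind_act_def Ind_mult const_map_def intro!: ext)
  then show ?thesis
    unfolding J_act_def J_class_def r_coset_def by (auto simp: image_UN)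
qed

lemma J_class_pow:
  assumes "H_invariant G H f"
  shows "jc f [^]\<^bsub>J\<^esub> (k::nat) = jc (\<lambda>x. int k * f x)"
proof (induction k)
  case (Suc k)
  have "H_invariant G H (\<lambda>x. int k * f x)" using assms by (simp add: H_invariant_def)
  then show ?case using Suc J_class_mult[OF _ assms, of "\<lambda>x. int k * f x"]
    by (simp add: algebra_simps)
qed (simp add: J_one)

lemma H_invariant_shift: "\<lbrakk>H_invariant G H f; g \<in> carrier G\<rbrakk> \<Longrightarrow> H_invariant G H (\<lambda>x. f (x \<otimes> g))"
  using H_closed by (simp add: H_invariant_def m_assoc)

text \<open>Representatives are chosen value by value. The cocycle identity is known only in J, so
  for the lifts it holds up to a constant function depending on g, h, k.\<close>

lemma cocycle_lift:
  assumes c: "c \<in> carrier (cocycles2 G J (J_act G))"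
  obtains F where "\<And>g h. \<lbrakk>g \<in> carrier G; h \<in> carrier G\<rbrakk> \<Longrightarrow> H_invariant G H (F g h)"
    and "\<And>g h. \<lbrakk>g \<in> carrier G; h \<in> carrier G\<rbrakk> \<Longrightarrow> c (g, h) = jc (F g h)"
    and "\<And>g h k. \<lbrakk>g \<in> carrier G; h \<in> carrier G; k \<in> carrier G\<rbrakk> \<Longrightarrow>
      \<exists>z. \<forall>x\<in>carrier G. F h k (x \<otimes> g) - F (g \<otimes> h) k x + F g (h \<otimes> k) x - F g h x = z"
proof -
  have cl: "c (g, h) \<in> carrier J" if "g \<in> carrier G" "h \<in> carrier G" for g h
    using c that by (auto simp: cocycles2_def kernel_def cochains2_def)
  define F where "F g h = J_lift (c (g, h))" for g h
  have F: "H_invariant G H (F g h) \<and> c (g, h) = jc (F g h)" if "g \<in> carrier G" "h \<in> carrier G" for g h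
    using J_lift[OF cl[OF that]] by (simp add: F_def)
  have "\<exists>z. \<forall>x\<in>carrier G. F h k (x \<otimes> g) - F (g \<otimes> h) k x + F g (h \<otimes> k) x - F g h x = z"
    if g: "g \<in> carrier G" and h: "h \<in> carrier G" and k: "k \<in> carrier G" for g h k
  proof -
    have "diff2 G J (J_act G) c = \<one>\<^bsub>cochains3 G J\<^esub>" using c by (simp add: cocycles2_def kernel_def)
    from fun_cong[OF this, of "(g, h, k)"]
    have 1: "J_act G g (c (h, k)) \<otimes>\<^bsub>J\<^esub> inv\<^bsub>J\<^esub> c (g \<otimes> h, k) \<otimes>\<^bsub>J\<^esub> c (g, h \<otimes> k) \<otimes>\<^bsub>J\<^esub> inv\<^bsub>J\<^esub> c (g, h) = \<one>\<^bsub>J\<^esub>"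
      using g h k by (simp add: diff2_def cochains3_def)
    note Fi = F[OF h k] F[OF m_closed[OF g h] k] F[OF g m_closed[OF h k]] F[OF g h]
    have i1: "H_invariant G H (\<lambda>x. F h k (x \<otimes> g))" by (rule H_invariant_shift[OF conjunct1[OF Fi(1)] g])
    have i2: "H_invariant G H (\<lambda>x. - F (g \<otimes> h) k x)" "H_invariant G H (\<lambda>x. - F g h x)"
      using Fi by (simp_all add: H_invariant_def)
    have i3: "H_invariant G H (\<lambda>x. F h k (x \<otimes> g) + - F (g \<otimes> h) k x)"
      using i1 i2 by (simp add: H_invariant_def)
    have i4: "H_invariant G H (\<lambda>x. F h k (x \<otimes> g) + - F (g \<otimes> h) k x + F g (h \<otimes> k) x)"
      using i3 Fi by (simp add: H_invariant_def)
    have i5: "H_invariant G H (\<lambda>x. F h k (x \<otimes> g) + - F (g \<otimes> h) k x + F g (h \<otimes> k) x + - F g h x)"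
      using i4 i2 by (simp add: H_invariant_def)
    have "jc (\<lambda>x. F h k (x \<otimes> g) + - F (g \<otimes> h) k x + F g (h \<otimes> k) x + - F g h x) = jc (\<lambda>_. 0)"
      using 1 Fi i1 i2 i3 i4 g by (simp only: J_class_act J_class_inv J_class_mult J_one)
    then obtain z where "\<forall>x\<in>carrier G. F h k (x \<otimes> g) + - F (g \<otimes> h) k x + F g (h \<otimes> k) x + - F g h x = 0 + z"
      using J_class_eq_iff[OF i5, of "\<lambda>_. 0"] by (auto simp: H_invariant_def)
    then show ?thesis by (intro exI[of _ z]) simp
  qed
  then show thesis using that F by blast
qed

text \<open>The bridge between cochains in J and functions with integer values. It is applied
  forwards to cyclic subgroups and to a torsion multiple on all of G, and backwards to conclude on
  G.\<close>

lemma coboundary_iff_int_splits_on: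
  assumes D: "subgroup D G" and c: "c \<in> extensional (carrier G \<times> carrier G)"
    and inv: "\<And>g h. \<lbrakk>g \<in> carrier G; h \<in> carrier G\<rbrakk> \<Longrightarrow> H_invariant G H (F g h)"
    and cF: "\<And>g h. \<lbrakk>g \<in> carrier G; h \<in> carrier G\<rbrakk> \<Longrightarrow> c (g, h) = jc (F g h)"
  shows "restrict c (D \<times> D) \<in> coboundaries2 (restrict_group G D) J (J_act G) \<longleftrightarrow> int_splits_on G H D F"
proof -
  have DG: "s \<in> carrier G" if "s \<in> D" for s using D that by (rule subgroup.mem_carrier)
  note Dm = subgroup.m_closed[OF D]
  have d_inv: "H_invariant G H (\<lambda>x. b t (x \<otimes> s) + - b (s \<otimes> t) x)"
    "H_invariant G H (\<lambda>x. b t (x \<otimes> s) + - b (s \<otimes> t) x + b s x)"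
    "H_invariant G H (\<lambda>x. b t (x \<otimes> s))" "H_invariant G H (\<lambda>x. - b (s \<otimes> t) x)"
    if b: "\<And>s. s \<in> D \<Longrightarrow> H_invariant G H (b s)" and st: "s \<in> D" "t \<in> D" for b :: "'g \<Rightarrow> 'g \<Rightarrow> int" and s t
    using H_invariant_shift[OF b[OF st(2)] DG[OF st(1)]] b[OF st(1)] b[OF Dm[OF st]]
    by (simp_all add: H_invariant_def)
  have d_jc: "J_act G s (jc (b t)) \<otimes>\<^bsub>J\<^esub> inv\<^bsub>J\<^esub> jc (b (s \<otimes> t)) \<otimes>\<^bsub>J\<^esub> jc (b s) =
      jc (\<lambda>x. b t (x \<otimes> s) + - b (s \<otimes> t) x + b s x)"
    if b: "\<And>s. s \<in> D \<Longrightarrow> H_invariant G H (b s)" and st: "s \<in> D" "t \<in> D" for b :: "'g \<Rightarrow> 'g \<Rightarrow> int" and s t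
    using d_inv[of b, OF b st] b[OF st(1)] b[OF Dm[OF st]] DG[OF st(1)]
    by (simp only: J_class_act J_class_inv J_class_mult)
  show ?thesis
  proof
    assume "restrict c (D \<times> D) \<in> coboundaries2 (restrict_group G D) J (J_act G)"
    then obtain \<beta> where \<beta>: "\<beta> \<in> carrier (cochains1 (restrict_group G D) J)"
      "restrict c (D \<times> D) = diff1 (restrict_group G D) J (J_act G) \<beta>"
      by (auto simp: coboundaries2_def)
    have cl: "\<beta> s \<in> carrier J" if "s \<in> D" for s using \<beta>(1) that by (auto simp: cochains1_def)
    define b where "b s = J_lift (\<beta> s)" for s
    have b: "H_invariant G H (b s)" "\<beta> s = jc (b s)" if "s \<in> D" for s
      using J_lift[OF cl[OF that]] by (simp_all add: b_def)
    have "\<exists>z. \<forall>x\<in>carrier G. F s t x = b t (x \<otimes> s) + - b (s \<otimes> t) x + b s x + z"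
      if st: "s \<in> D" "t \<in> D" for s t
    proof -
      have "jc (F s t) = J_act G s (\<beta> t) \<otimes>\<^bsub>J\<^esub> inv\<^bsub>J\<^esub> \<beta> (s \<otimes> t) \<otimes>\<^bsub>J\<^esub> \<beta> s"
        using fun_cong[OF \<beta>(2), of "(s, t)"] st DG by (simp add: diff1_def cF)
      also have "\<dots> = jc (\<lambda>x. b t (x \<otimes> s) + - b (s \<otimes> t) x + b s x)"
        using d_jc[of b, OF _ st] b(1) b(2) st Dm[OF st] by simp
      finally show ?thesis
        using J_class_eq_iff[OF inv[OF DG[OF st(1)] DG[OF st(2)]] d_inv(2)[of b, OF _ st]] b(1) by blast
    qed
    then obtain z where "\<forall>s\<in>D. \<forall>t\<in>D. \<forall>x\<in>carrier G. F s t x = b t (x \<otimes> s) + - b (s \<otimes> t) x + b s x + z s t"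
      by metis
    then show "int_splits_on G H D F" using b(1) unfolding int_splits_on_def by (intro exI[of _ b] exI[of _ z]) simp
  next
    assume "int_splits_on G H D F"
    then obtain b z where b: "\<And>s. s \<in> D \<Longrightarrow> H_invariant G H (b s)"
      and z: "\<And>s t x. \<lbrakk>s \<in> D; t \<in> D; x \<in> carrier G\<rbrakk> \<Longrightarrow> F s t x = b t (x \<otimes> s) - b (s \<otimes> t) x + b s x + z s t"
      unfolding int_splits_on_def by blast
    define \<beta> where "\<beta> = (\<lambda>s\<in>D. jc (b s))"
    have "\<beta> \<in> carrier (cochains1 (restrict_group G D) J)"
      using b by (auto simp: \<beta>_def cochains1_def J_class_closed)
    moreover have "restrict c (D \<times> D) = diff1 (restrict_group G D) J (J_act G) \<beta>"
    proof
      fix st show "restrict c (D \<times> D) st = diff1 (restrict_group G D) J (J_act G) \<beta> st"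
      proof (cases "st \<in> D \<times> D")
        case True
        then obtain s t where st: "st = (s, t)" "s \<in> D" "t \<in> D" by auto
        have "jc (F s t) = jc (\<lambda>x. b t (x \<otimes> s) + - b (s \<otimes> t) x + b s x)"
          using J_class_eq_iff[OF inv[OF DG[OF st(2)] DG[OF st(3)]] d_inv(2)[of b, OF _ st(2,3)]] b z[OF st(2,3)] by auto
        also have "\<dots> = J_act G s (jc (b t)) \<otimes>\<^bsub>J\<^esub> inv\<^bsub>J\<^esub> jc (b (s \<otimes> t)) \<otimes>\<^bsub>J\<^esub> jc (b s)"
          using d_jc[of b, OF _ st(2,3)] b by simp
        finally show ?thesis using st DG Dm by (simp add: \<beta>_def diff1_def cF)
      qed (auto simp: diff1_def)
    qed
    ultimately show "restrict c (D \<times> D) \<in> coboundaries2 (restrict_group G D) J (J_act G)"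
      unfolding coboundaries2_def by blast
  qed
qed

text \<open>Over the reals, cohomology of a finite group vanishes in positive degree: averaging the
  cocycle identity over its first variable exhibits \<open>F\<close> as a coboundary, up to
  constants.\<close>

lemma average_cocycle:
  assumes fin: "finite (carrier G)"
    and inv: "\<And>g h. \<lbrakk>g \<in> carrier G; h \<in> carrier G\<rbrakk> \<Longrightarrow> H_invariant G H (F g h)"
    and F: "\<And>g h k. \<lbrakk>g \<in> carrier G; h \<in> carrier G; k \<in> carrier G\<rbrakk> \<Longrightarrow>
      \<exists>z. \<forall>x\<in>carrier G. F h k (x \<otimes> g) - F (g \<otimes> h) k x + F g (h \<otimes> k) x - F g h x = z"
  obtains B :: "'g \<Rightarrow> 'g \<Rightarrow> real" and w where "\<And>g. g \<in> carrier G \<Longrightarrow> H_invariant G H (B g)"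
    and "\<And>g h x. \<lbrakk>g \<in> carrier G; h \<in> carrier G; x \<in> carrier G\<rbrakk> \<Longrightarrow>
      of_int (F g h x) = B h (x \<otimes> g) - B (g \<otimes> h) x + B g x + w g h"
proof -
  have "\<exists>z. \<forall>g\<in>carrier G. \<forall>h\<in>carrier G. \<forall>k\<in>carrier G. \<forall>x\<in>carrier G.
      F h k (x \<otimes> g) - F (g \<otimes> h) k x + F g (h \<otimes> k) x - F g h x = z g h k"
    using F by metis
  then obtain z where z: "\<And>g h k x. \<lbrakk>g \<in> carrier G; h \<in> carrier G; k \<in> carrier G; x \<in> carrier G\<rbrakk> \<Longrightarrow>
      F h k (x \<otimes> g) - F (g \<otimes> h) k x + F g (h \<otimes> k) x - F g h x = z g h k" by blast
  \<comment> \<open>The shift by the inverse of g undoes the action of g in the cocycle identity, so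
    that summing over g leaves \<open>F h k x\<close> with factor \<open>order G\<close>.\<close>
  define A where "A h x = (\<Sum>g\<in>carrier G. F g h (x \<otimes> inv g))" for h x
  define n where "n = int (order G)"
  have n: "n > 0" using fin order_gt_0_iff_finite by (simp add: n_def)
  have A: "n * F h k x = A k (x \<otimes> h) - A (h \<otimes> k) x + A h x + (\<Sum>g\<in>carrier G. z g h k)"
    if h: "h \<in> carrier G" and k: "k \<in> carrier G" and x: "x \<in> carrier G" for h k x
  proof -
    have "F h k x = F (g \<otimes> h) k (x \<otimes> inv g) - F g (h \<otimes> k) (x \<otimes> inv g) + F g h (x \<otimes> inv g) + z g h k"
      if "g \<in> carrier G" for g
      using z[OF that h k, of "x \<otimes> inv g"] x that by (simp add: m_assoc)
    then have "(\<Sum>g\<in>carrier G. F h k x) = (\<Sum>g\<in>carrier G. F (g \<otimes> h) k (x \<otimes> inv g) -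
        F g (h \<otimes> k) (x \<otimes> inv g) + F g h (x \<otimes> inv g) + z g h k)"
      by (rule sum.cong[OF refl])
    moreover have "(\<Sum>g\<in>carrier G. F (g \<otimes> h) k (x \<otimes> inv g)) = A k (x \<otimes> h)"
    proof -
      have "bij_betw (\<lambda>g. g \<otimes> h) (carrier G) (carrier G)"
        by (rule bij_betwI[of _ _ _ "\<lambda>g. g \<otimes> inv h"]) (use h in \<open>auto simp: m_assoc\<close>)
      from sum.reindex_bij_betw[OF this, of "\<lambda>g. F g k (x \<otimes> h \<otimes> inv g)"]
      have "(\<Sum>g\<in>carrier G. F (g \<otimes> h) k (x \<otimes> h \<otimes> inv (g \<otimes> h))) = A k (x \<otimes> h)"
        by (simp add: A_def)
      moreover have "x \<otimes> h \<otimes> inv (g \<otimes> h) = x \<otimes> inv g" if "g \<in> carrier G" for g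
        using that h x by (simp add: inv_mult_group m_assoc mult_inv_cancel_left)
      ultimately show ?thesis by (simp cong: sum.cong)
    qed
    ultimately show ?thesis
      by (simp add: n_def order_def A_def sum.distrib sum_subtractf)
  qed
  show thesis
  proof (rule that[of "\<lambda>h x. of_int (A h x) / of_int n" "\<lambda>h k. of_int (\<Sum>g\<in>carrier G. z g h k) / of_int n"])
    fix h assume "h \<in> carrier G"
    then show "H_invariant G H (\<lambda>x. real_of_int (A h x) / of_int n)"
      using inv H_closed by (simp add: H_invariant_def A_def m_assoc)
  next
    fix h k x assume *: "h \<in> carrier G" "k \<in> carrier G" "x \<in> carrier G"
    have "real_of_int (n * F h k x) = of_int (A k (x \<otimes> h)) - of_int (A (h \<otimes> k) x) + of_int (A h x)
        + of_int (\<Sum>g\<in>carrier G. z g h k)"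
      unfolding A[OF *] by simp
    then show "real_of_int (F h k x) = of_int (A k (x \<otimes> h)) / of_int n - of_int (A (h \<otimes> k) x) / of_int n
        + of_int (A h x) / of_int n + of_int (\<Sum>g\<in>carrier G. z g h k) / of_int n"
      using n by (simp add: field_simps)
  qed
qed

text \<open>Dimension shifting along the sequence from the integers through the reals to the circle.
  If \<open>F\<close> is the coboundary of an integral b up to constants, then B - b is a real
  cocycle modulo constants, hence a coboundary by averaging, and b vanishes in the circle.
  Conversely, lifting \<phi> and \<mu> to the reals leaves an integral remainder b.\<close>

lemma int_splits_on_iff_splits_on:
  fixes B :: "'g \<Rightarrow> 'g \<Rightarrow> real"
  assumes D: "subgroup D G" "finite D" and inv: "\<And>g. g \<in> carrier G \<Longrightarrow> H_invariant G H (B g)"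
    and F: "\<And>g h x. \<lbrakk>g \<in> carrier G; h \<in> carrier G; x \<in> carrier G\<rbrakk> \<Longrightarrow>
      of_int (F g h x) = B h (x \<otimes> g) - B (g \<otimes> h) x + B g x + w g h"
  shows "int_splits_on G H D F \<longleftrightarrow> splits_on G H D (\<lambda>g x. to_circle (B g x))"
proof
  have DG: "s \<in> carrier G" if "s \<in> D" for s using D(1) that by (rule subgroup.mem_carrier)
  note Dm = subgroup.m_closed[OF D(1)]
  {
    assume "int_splits_on G H D F"
    then obtain b z where b: "\<And>s. s \<in> D \<Longrightarrow> H_invariant G H (b s)"
      and z: "\<And>s t x. \<lbrakk>s \<in> D; t \<in> D; x \<in> carrier G\<rbrakk> \<Longrightarrow> F s t x = b t (x \<otimes> s) - b (s \<otimes> t) x + b s x + z s t"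
      unfolding int_splits_on_def by blast
    define A where "A s x = B s x - of_int (b s x)" for s x
    define n where "n = real (card D)"
    have n: "n > 0" using D subgroup.one_closed[OF D(1)] by (auto simp: n_def card_gt_0_iff)
    have A: "A s x = A (s \<otimes> t) x - A t (x \<otimes> s) + (of_int (z s t) - w s t)"
      if "s \<in> D" "t \<in> D" "x \<in> carrier G" for s t x
    proof -
      have "of_int (F s t x) = B t (x \<otimes> s) - B (s \<otimes> t) x + B s x + w s t"
        using F[of s t x] that DG by simp
      then show ?thesis using z[OF that] by (simp add: A_def)
    qed
    \<comment> \<open>The averaging primitive: summing the relation \<open>A\<close> over t in
      \<open>D\<close> expresses \<open>n * A s x\<close> through the sum at x minus the sum at x s,
      which explains the sign.\<close>
    define \<phi> where "\<phi> x = - (\<Sum>t\<in>D. A t x) / n" for x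
    define \<mu> where "\<mu> s = (\<Sum>t\<in>D. of_int (z s t) - w s t) / n" for s
    have sum: "A s x = \<phi> (x \<otimes> s) - \<phi> x + \<mu> s" if s: "s \<in> D" and x: "x \<in> carrier G" for s x
    proof -
      have "(\<Sum>t\<in>D. A s x) = (\<Sum>t\<in>D. A (s \<otimes> t) x - A t (x \<otimes> s) + (of_int (z s t) - w s t))"
        by (rule sum.cong[OF refl]) (rule A[OF s _ x])
      moreover have "(\<Sum>t\<in>D. A (s \<otimes> t) x) = (\<Sum>t\<in>D. A t x)"
      proof -
        have "bij_betw (\<lambda>t. s \<otimes> t) D D"
          by (rule bij_betwI[of _ _ _ "\<lambda>t. inv s \<otimes> t"])
            (use s DG in \<open>auto simp: Dm subgroup.m_inv_closed[OF D(1)] mult_inv_cancel_left\<close>)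
        from sum.reindex_bij_betw[OF this, of "\<lambda>t. A t x"] show ?thesis .
      qed
      ultimately have "n * A s x = (\<Sum>t\<in>D. A t x) - (\<Sum>t\<in>D. A t (x \<otimes> s)) + (\<Sum>t\<in>D. of_int (z s t) - w s t)"
        by (simp add: n_def sum.distrib sum_subtractf)
      then show ?thesis using n by (simp add: \<phi>_def \<mu>_def field_simps)
    qed
    show "splits_on G H D (\<lambda>g x. to_circle (B g x))"
    proof (rule splits_onI[where \<phi> = "\<lambda>x. to_circle (\<phi> x)" and \<mu> = "\<lambda>s. to_circle (\<mu> s)"])
      fix h x assume hx: "h \<in> H" "x \<in> carrier G"
      have "A t (h \<otimes> x) = A t x" if "t \<in> D" for t
        using inv[OF DG[OF that]] b[OF that] hx by (simp add: A_def H_invariant_def)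
      then show "to_circle (\<phi> (h \<otimes> x)) = to_circle (\<phi> x)" by (simp add: \<phi>_def cong: sum.cong)
    next
      fix s x assume "s \<in> D" "x \<in> carrier G"
      then have "B s x - (\<phi> (x \<otimes> s) - \<phi> x + \<mu> s) = of_int (b s x)"
        using sum[of s x] by (simp add: A_def)
      then have "to_circle (B s x) = to_circle (\<phi> (x \<otimes> s) - \<phi> x + \<mu> s)"
        by (simp add: to_circle_eq_iff)
      then show "to_circle (B s x) = to_circle (\<phi> (x \<otimes> s)) - to_circle (\<phi> x) + to_circle (\<mu> s)"
        by (simp add: to_circle_add to_circle_diff)
    qed
  next
    assume "splits_on G H D (\<lambda>g x. to_circle (B g x))"
    then obtain \<phi> \<mu> where \<phi>: "\<And>h x. \<lbrakk>h \<in> H; x \<in> carrier G\<rbrakk> \<Longrightarrow> \<phi> (h \<otimes> x) = \<phi> x"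
      and \<mu>: "\<And>s x. \<lbrakk>s \<in> D; x \<in> carrier G\<rbrakk> \<Longrightarrow> to_circle (B s x) = \<phi> (x \<otimes> s) - \<phi> x + \<mu> s"
      by (rule splits_onE) blast
    obtain r where r: "\<And>a. to_circle (r a) = a" using to_circle_surj by metis
    \<comment> \<open>For s in \<open>D\<close> and x in G the argument of the floor is already an
      integer, because both terms agree in the circle; the floor only changes the type.\<close>
    define b where "b s x = \<lfloor>B s x - (r (\<phi> (x \<otimes> s)) - r (\<phi> x) + r (\<mu> s))\<rfloor>" for s x
    have b: "of_int (b s x) = B s x - (r (\<phi> (x \<otimes> s)) - r (\<phi> x) + r (\<mu> s))"
      if "s \<in> D" "x \<in> carrier G" for s x
    proof -
      have "to_circle (B s x) = to_circle (r (\<phi> (x \<otimes> s)) - r (\<phi> x) + r (\<mu> s))"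
        by (simp add: \<mu>[OF that] to_circle_add to_circle_diff r)
      then show ?thesis by (simp add: to_circle_eq_iff b_def)
    qed
    have b_inv: "H_invariant G H (b s)" if "s \<in> D" for s
      using inv[OF DG[OF that]] \<phi> DG[OF that] H_closed by (simp add: H_invariant_def b_def m_assoc)
    \<comment> \<open>The remaining real constant is a difference of integers by \<open>Fb\<close>,
      so its floor serves as the integral constant.\<close>
    define u where "u s t = w s t + r (\<mu> s) + r (\<mu> t) - r (\<mu> (s \<otimes> t))" for s t
    have Fb: "of_int (F s t x) = of_int (b t (x \<otimes> s) - b (s \<otimes> t) x + b s x) + u s t"
      if "s \<in> D" "t \<in> D" "x \<in> carrier G" for s t x
      using F[of s t x] b[of t "x \<otimes> s"] b[of "s \<otimes> t" x] b[of s x] that DG Dm by (simp add: u_def m_assoc)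
    have "F s t x = b t (x \<otimes> s) - b (s \<otimes> t) x + b s x + \<lfloor>u s t\<rfloor>"
      if "s \<in> D" "t \<in> D" "x \<in> carrier G" for s t x
    proof -
      have "u s t = of_int (F s t x - (b t (x \<otimes> s) - b (s \<otimes> t) x + b s x))" using Fb[OF that] by simp
      then have "\<lfloor>u s t\<rfloor> = F s t x - (b t (x \<otimes> s) - b (s \<otimes> t) x + b s x)" by (simp only: floor_of_int)
      then show ?thesis by simp
    qed
    then show "int_splits_on G H D F"
      unfolding int_splits_on_def using b_inv by (intro exI[of _ b] exI[of _ "\<lambda>s t. \<lfloor>u s t\<rfloor>"]) simp
  }
qed

end


section \<open>Torsion classes\<close>

text \<open>For the case m \<le> 1: S has order 1 or p and is cyclic, so triviality on cyclic
  subgroups already covers S.\<close>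

lemma (in group) card_prime_power_le_imp_generate:
  assumes S: "subgroup S G" "finite S" and p: "prime p" "card S = p ^ m" "m \<le> 1"
  obtains s where "s \<in> S" "generate G {s} = S"
proof -
  have SG: "S \<subseteq> carrier G" using S(1) by (rule subgroup.subset)
  show thesis
  proof (cases "S = {\<one>}")
    case True
    then show thesis using that[of \<one>] generate_subgroup_incl[of "{\<one>}" S] S generate.one by blast
  next
    case False
    then obtain s where s: "s \<in> S" "s \<noteq> \<one>" using subgroup.one_closed[OF S(1)] by blast
    have gen: "subgroup (generate G {s}) G" using s SG by (intro generate_is_subgroup) blast
    have sub: "generate G {s} \<subseteq> S" using generate_subgroup_incl[of "{s}" S] s S by blast
    have "card (generate G {s}) dvd p"
      using card_dvd_card_subgroup[OF gen S(1) sub] p(2,3) by (cases m) auto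
    moreover have "card (generate G {s}) \<noteq> 1"
    proof
      assume "card (generate G {s}) = 1"
      then obtain y where "generate G {s} = {y}" by (auto simp: card_1_singleton_iff)
      moreover have "s \<in> generate G {s}" "\<one> \<in> generate G {s}" by (auto intro: generate.intros)
      ultimately show False using s by auto
    qed
    ultimately have "card (generate G {s}) = p" using p(1) by (auto simp: prime_nat_iff)
    moreover have "card S = p"
    proof (cases m)
      case 0
      then have "card S = 1" using p by simp
      then show ?thesis using s subgroup.one_closed[OF S(1)] by (auto simp: card_1_singleton_iff)
    qed (use p in auto)
    ultimately have "generate G {s} = S" using card_subset_eq[OF S(2) sub] by simp
    then show thesis using that s by blast
  qed
qed

section \<open>From triviality on cyclic subgroups to a global coboundary\<close>

context induced_module
begin

interpretation mod: group_module G J "J_act G"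
  by (rule group_module_J_mod)

lemma cochain_pow:
  "(c [^]\<^bsub>cocycles2 G J (J_act G)\<^esub> (q::nat)) = (\<lambda>gh\<in>carrier G \<times> carrier G. c gh [^]\<^bsub>J\<^esub> q)"
  by (induction q) (auto simp: cocycles2_def cochains2_def intro!: ext)

text \<open>The class splits over S, hence its multiple by the index of S splits over G; so does its
  multiple by a power of p, and the two factors are coprime. \<open>index\<close> is confined to m
  \<ge> 3 because it fails for trivial S.\<close>

lemma torsion_cocycle_is_coboundary:
  assumes fin: "finite (carrier G)" and c: "c \<in> carrier (cocycles2 G J (J_act G))"
    and S: "subgroup S G" "card S = p ^ multiplicity p (order G)" "card S = p ^ m"
    and p: "prime p" and m: "m \<noteq> 2"
    and comm: "\<And>s t. \<lbrakk>s \<in> S; t \<in> S\<rbrakk> \<Longrightarrow> s \<otimes> t = t \<otimes> s"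
    and index: "\<And>x. \<lbrakk>m \<ge> 3; x \<in> carrier G\<rbrakk> \<Longrightarrow> card S = p * card {s \<in> S. x \<otimes> s \<otimes> inv x \<in> H}"
    and core: "\<And>s. \<lbrakk>s \<in> S; \<And>x. x \<in> carrier G \<Longrightarrow> x \<otimes> s \<otimes> inv x \<in> H\<rbrakk> \<Longrightarrow> s = \<one>"
    and cyc: "\<And>s. s \<in> S \<Longrightarrow> restrict c (generate G {s} \<times> generate G {s})
      \<in> coboundaries2 (restrict_group G (generate G {s})) J (J_act G)"
    and tors: "c [^]\<^bsub>cocycles2 G J (J_act G)\<^esub> p ^ e \<in> coboundaries2 G J (J_act G)"
  shows "c \<in> coboundaries2 G J (J_act G)"
proof -
  have SG: "s \<in> carrier G" if "s \<in> S" for s using S(1) that by (rule subgroup.mem_carrier)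
  have finS: "finite S" using finite_subset[OF subgroup.subset[OF S(1)] fin] .
  have ext: "c \<in> extensional (carrier G \<times> carrier G)"
    using c by (auto simp: cocycles2_def kernel_def cochains2_def PiE_iff)
  obtain F where F_inv: "\<And>g h. \<lbrakk>g \<in> carrier G; h \<in> carrier G\<rbrakk> \<Longrightarrow> H_invariant G H (F g h)"
    and cF: "\<And>g h. \<lbrakk>g \<in> carrier G; h \<in> carrier G\<rbrakk> \<Longrightarrow> c (g, h) = jc (F g h)"
    and F_coc: "\<And>g h k. \<lbrakk>g \<in> carrier G; h \<in> carrier G; k \<in> carrier G\<rbrakk> \<Longrightarrow>
      \<exists>z. \<forall>x\<in>carrier G. F h k (x \<otimes> g) - F (g \<otimes> h) k x + F g (h \<otimes> k) x - F g h x = z"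
    using cocycle_lift[OF c] by blast
  obtain B w where B_inv: "\<And>g. g \<in> carrier G \<Longrightarrow> H_invariant G H (B g)"
    and FB: "\<And>g h x. \<lbrakk>g \<in> carrier G; h \<in> carrier G; x \<in> carrier G\<rbrakk> \<Longrightarrow>
      real_of_int (F g h x) = B h (x \<otimes> g) - B (g \<otimes> h) x + B g x + w g h"
    using average_cocycle[OF fin F_inv F_coc] by blast
  interpret tw: twisted_cocycle G H "\<lambda>g x. to_circle (B g x)" "\<lambda>g h. to_circle (- w g h)"
  proof (intro twisted_cocycle.intro twisted_cocycle_axioms.intro is_group H_subgroup)
    fix g h x assume g: "g \<in> carrier G" "h \<in> carrier G" "x \<in> carrier G"
    have "B h (x \<otimes> g) - B (g \<otimes> h) x + B g x - (- w g h) = of_int (F g h x)" using FB[OF g] by simp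
    then have "to_circle (B h (x \<otimes> g) - B (g \<otimes> h) x + B g x) = to_circle (- w g h)"
      unfolding to_circle_eq_iff by simp
    then show "to_circle (B h (x \<otimes> g)) - to_circle (B (g \<otimes> h) x) + to_circle (B g x) = to_circle (- w g h)"
      by (simp add: to_circle_add to_circle_diff)
  qed (use B_inv in \<open>simp add: H_invariant_def\<close>)
  let ?B = "\<lambda>g x. to_circle (B g x)"
  have iff: "restrict c (D \<times> D) \<in> coboundaries2 (restrict_group G D) J (J_act G) \<longleftrightarrow> splits_on G H D ?B"
    if D: "subgroup D G" for D
    using coboundary_iff_int_splits_on[OF D ext F_inv cF]
      int_splits_on_iff_splits_on[OF D finite_subset[OF subgroup.subset[OF D] fin] B_inv FB] by simp
  have gen: "splits_on G H (generate G {s}) ?B" if "s \<in> S" for s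
    using cyc[OF that] iff[of "generate G {s}"] generate_is_subgroup[of "{s}"] SG[OF that] by simp
  have "splits_on G H S ?B"
  proof (cases "m \<le> 1")
    case True
    then obtain s where "s \<in> S" "generate G {s} = S"
      using card_prime_power_le_imp_generate[OF S(1) finS p S(3)] by blast
    then show ?thesis using gen by metis
  next
    case False
    then have m3: "m \<ge> 3" using m by simp
    have "splits_on G H {s} ?B" if "s \<in> S" for s
      using gen[OF that] generate.incl[of s "{s}"] unfolding splits_on_def by blast
    then show ?thesis
      using tw.splits_on_abelian[OF S(1) finS comm p S(3) m3 index[OF m3] core] by blast
  qed
  then obtain k where k: "k * card S = order G" "splits_on G H (carrier G) (\<lambda>g x. \<Sum>i<k. ?B g x)"
    using tw.splits_on_transfer[OF fin S(1)] by blast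
  have ord: "order G \<noteq> 0" using fin by (simp add: order_gt_0_iff_finite)
  \<comment> \<open>The order of S is the full power of p in the order of G, so another factor p in
    the index k would exceed the multiplicity.\<close>
  have "\<not> p dvd k"
  proof
    assume "p dvd k"
    then have "p ^ Suc (multiplicity p (order G)) dvd order G"
      using k(1) S(2) by (metis mult_dvd_mono dvd_refl power_Suc)
    then show False using ord p multiplicity_geI[of "order G" p] not_prime_unit not_less_eq_eq by blast
  qed
  then have coprime: "coprime k (p ^ e)" 
    using prime_imp_coprime[OF p, of k] by (simp add: coprime_commute)
  \<comment> \<open>The torsion assumption is translated by the same two equivalences, applied to
    the q-fold data q F, q B, q w with q = p^e.\<close>
  have "splits_on G H (carrier G) (\<lambda>g x. \<Sum>i<p ^ e. ?B g x)"
  proof -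
    let ?c = "c [^]\<^bsub>cocycles2 G J (J_act G)\<^esub> p ^ e"
    define q where "q = p ^ e"
    have cq: "?c = (\<lambda>gh\<in>carrier G \<times> carrier G. c gh [^]\<^bsub>J\<^esub> q)" unfolding q_def by (rule cochain_pow)
    have "restrict ?c (carrier G \<times> carrier G) \<in> coboundaries2 (restrict_group G (carrier G)) J (J_act G)"
      using tors by (simp add: cq q_def)
    moreover have "H_invariant G H (\<lambda>x. int q * F g h x)" if "g \<in> carrier G" "h \<in> carrier G" for g h
      using F_inv[OF that] by (simp add: H_invariant_def)
    moreover have "?c (g, h) = jc (\<lambda>x. int q * F g h x)" if "g \<in> carrier G" "h \<in> carrier G" for g h
      using that J_class_pow[OF F_inv[OF that]] by (simp add: cq cF)
    ultimately have "int_splits_on G H (carrier G) (\<lambda>g h x. int q * F g h x)"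
      using coboundary_iff_int_splits_on[OF subgroup_self, of ?c "\<lambda>g h x. int q * F g h x"] by (simp add: cq)
    moreover have "H_invariant G H (\<lambda>x. real q * B g x)" if "g \<in> carrier G" for g
      using B_inv[OF that] by (simp add: H_invariant_def)
    moreover have "real_of_int (int q * F g h x) =
        real q * B h (x \<otimes> g) - real q * B (g \<otimes> h) x + real q * B g x + real q * w g h"
      if "g \<in> carrier G" "h \<in> carrier G" "x \<in> carrier G" for g h x
      by (simp add: FB[OF that] distrib_left right_diff_distrib)
    ultimately have "splits_on G H (carrier G) (\<lambda>g x. to_circle (real q * B g x))"
      using int_splits_on_iff_splits_on[OF subgroup_self fin, of "\<lambda>g x. real q * B g x"
          "\<lambda>g h x. int q * F g h x" "\<lambda>g h. real q * w g h"] by simp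
    moreover have "to_circle (real q * B g x) = (\<Sum>i<q. ?B g x)" for g x
      using to_circle_sum[of "\<lambda>_. B g x" "{..<q}"] by simp
    ultimately show ?thesis by (simp add: q_def)
  qed
  then have "splits_on G H (carrier G) ?B" by (rule splits_on_coprime[OF coprime k(2)])
  then show ?thesis using iff[OF subgroup_self] extensional_restrict[OF ext] by simp
qed

end

section \<open>Primary torsion of Sha in terms of cocycles\<close>

context group_module
begin

lemma primary_torsion_Sha2_obtain:
  assumes \<D>: "\<And>D. D \<in> \<D> \<Longrightarrow> subgroup D G" and x: "x \<in> primary_torsion p (Sha2 \<D> G M act)"
  obtains c e where "c \<in> carrier (cocycles2 G M act)"
    and "x = coboundaries2 G M act #>\<^bsub>cocycles2 G M act\<^esub> c"
    and "\<And>D. D \<in> \<D> \<Longrightarrow> restrict c (D \<times> D) \<in> coboundaries2 (restrict_group G D) M act"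
    and "c [^]\<^bsub>cocycles2 G M act\<^esub> p ^ e \<in> coboundaries2 G M act"
proof -
  interpret Z: comm_group "cocycles2 G M act" by (rule comm_group_cocycles2)
  interpret B: normal "coboundaries2 G M act" "cocycles2 G M act"
    by (rule Z.subgroup_imp_normal[OF subgroup_coboundaries2])
  have x1: "x \<in> carrier (H2 G M act)" and
    x2: "(\<lambda>D\<in>\<D>. res2 G M act D x) = (\<lambda>D\<in>\<D>. \<one>\<^bsub>H2 (restrict_group G D) M act\<^esub>)"
    using x by (auto simp: primary_torsion_def Sha2_def kernel_def)
  obtain c where c: "c \<in> carrier (cocycles2 G M act)" "x = coboundaries2 G M act #>\<^bsub>cocycles2 G M act\<^esub> c"
    using x1 by (auto simp: H2_def FactGroup_def RCOSETS_def)
  have "restrict c (D \<times> D) \<in> coboundaries2 (restrict_group G D) M act" if D: "D \<in> \<D>" for D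
  proof -
    interpret R: group_module "restrict_group G D" M act by (rule group_module_subgroup[OF \<D>[OF D]])
    interpret ZD: comm_group "cocycles2 (restrict_group G D) M act" by (rule R.comm_group_cocycles2)
    have "res2 G M act D x = coboundaries2 (restrict_group G D) M act"
      using fun_cong[OF x2, of D] D by (simp add: H2_def FactGroup_def)
    then have "coboundaries2 (restrict_group G D) M act #>\<^bsub>cocycles2 (restrict_group G D) M act\<^esub>
        restrict c (D \<times> D) = coboundaries2 (restrict_group G D) M act"
      using res2_rcoset[OF \<D>[OF D] c(1)] c(2) by simp
    then show ?thesis
      using ZD.rcos_self[OF restrict_cocycle[OF \<D>[OF D] c(1)] R.subgroup_coboundaries2] by simp
  qed
  moreover obtain e where "x [^]\<^bsub>Sha2 \<D> G M act\<^esub> p ^ e = \<one>\<^bsub>Sha2 \<D> G M act\<^esub>"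
    using x by (auto simp: primary_torsion_def)
  \<comment> \<open>\<open>Sha2\<close> changes only the carrier of \<open>H2\<close>, and powers
    depend only on multiplication and unit.\<close>
  then have "x [^]\<^bsub>H2 G M act\<^esub> p ^ e = coboundaries2 G M act"
    by (simp add: Sha2_def nat_pow_def H2_def FactGroup_def)
  then have "coboundaries2 G M act #>\<^bsub>cocycles2 G M act\<^esub> (c [^]\<^bsub>cocycles2 G M act\<^esub> p ^ e) = coboundaries2 G M act"
    using hom_nat_pow[OF B.r_coset_hom_Mod c(1) Z.is_group B.factorgroup_is_group, of "p ^ e"]
    by (simp add: H2_def c(2))
  then have "c [^]\<^bsub>cocycles2 G M act\<^esub> p ^ e \<in> coboundaries2 G M act"
    using Z.rcos_self[OF Z.nat_pow_closed[OF c(1)] subgroup_coboundaries2] by metis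
  ultimately show thesis using that c by blast
qed

lemma one_primary_torsion_Sha2:
  assumes "\<And>D. D \<in> \<D> \<Longrightarrow> subgroup D G"
  shows "\<one>\<^bsub>Sha2 \<D> G M act\<^esub> \<in> primary_torsion p (Sha2 \<D> G M act)"
proof -
  interpret H: comm_group "H2 G M act" by (rule comm_group_H2)
  have "res2 G M act D \<one>\<^bsub>H2 G M act\<^esub> = \<one>\<^bsub>H2 (restrict_group G D) M act\<^esub>" if D: "D \<in> \<D>" for D
  proof -
    interpret R: group_module "restrict_group G D" M act by (rule group_module_subgroup[OF assms[OF D]])
    interpret HD: comm_group "H2 (restrict_group G D) M act" by (rule R.comm_group_H2)
    show ?thesis using hom_one[OF res2_hom[OF assms[OF D]] H.is_group HD.is_group] .
  qed
  then have "(\<lambda>D\<in>\<D>. res2 G M act D \<one>\<^bsub>H2 G M act\<^esub>) = (\<lambda>D\<in>\<D>. \<one>\<^bsub>H2 (restrict_group G D) M act\<^esub>)"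
    by (rule restrict_ext)
  then show ?thesis
    by (auto simp: primary_torsion_def Sha2_def kernel_def intro!: exI[of _ 0])
qed

text \<open>Reduces vanishing to a statement about one cocycle: a class is trivial when its
  representative is a coboundary. The unit itself belongs to the torsion part because restrictions
  are homomorphisms.\<close>

lemma primary_torsion_Sha2_trivialI:
  assumes \<D>: "\<And>D. D \<in> \<D> \<Longrightarrow> subgroup D G"
    and c: "\<And>c e. \<lbrakk>c \<in> carrier (cocycles2 G M act);
      \<And>D. D \<in> \<D> \<Longrightarrow> restrict c (D \<times> D) \<in> coboundaries2 (restrict_group G D) M act;
      c [^]\<^bsub>cocycles2 G M act\<^esub> p ^ e \<in> coboundaries2 G M act\<rbrakk> \<Longrightarrow> c \<in> coboundaries2 G M act"
  shows "primary_torsion p (Sha2 \<D> G M act) = {\<one>\<^bsub>Sha2 \<D> G M act\<^esub>}"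
proof -
  interpret Z: comm_group "cocycles2 G M act" by (rule comm_group_cocycles2)
  have "x = \<one>\<^bsub>Sha2 \<D> G M act\<^esub>" if x: "x \<in> primary_torsion p (Sha2 \<D> G M act)" for x
  proof -
    obtain b e where b: "b \<in> carrier (cocycles2 G M act)"
      "x = coboundaries2 G M act #>\<^bsub>cocycles2 G M act\<^esub> b"
      "\<And>D. D \<in> \<D> \<Longrightarrow> restrict b (D \<times> D) \<in> coboundaries2 (restrict_group G D) M act"
      "b [^]\<^bsub>cocycles2 G M act\<^esub> p ^ e \<in> coboundaries2 G M act"
      by (rule primary_torsion_Sha2_obtain[OF \<D> x]) (auto intro: that)
    have "b \<in> coboundaries2 G M act" using c[OF b(1,3,4)] .
    then have "x = coboundaries2 G M act"
      using b(2) Z.coset_join2[OF b(1) subgroup_coboundaries2] by simp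
    then show ?thesis by (simp add: Sha2_def H2_def FactGroup_def)
  qed
  then show ?thesis using one_primary_torsion_Sha2[OF \<D>, where p = p] by blast
qed

end

section \<open>Elementary abelian groups and permutation actions\<close>

lemma elementary_abelian_card_comm:
  assumes iso: "A \<cong> product_group {..<m} (\<lambda>_. integer_mod_group p)" and "p > 0" and A: "group A"
  shows "card (carrier A) = p ^ m"
    and "\<lbrakk>s \<in> carrier A; t \<in> carrier A\<rbrakk> \<Longrightarrow> s \<otimes>\<^bsub>A\<^esub> t = t \<otimes>\<^bsub>A\<^esub> s"
proof -
  let ?P = "product_group {..<m} (\<lambda>_. integer_mod_group p)"
  interpret A: group A by fact
  interpret Z: comm_group "integer_mod_group p" by simp
  obtain f where f: "f \<in> hom A ?P" "bij_betw f (carrier A) (carrier ?P)"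
    using iso by (auto simp: is_iso_def iso_def)
  have "card (carrier A) = card (carrier ?P)" using f(2) by (rule bij_betw_same_card)
  then show "card (carrier A) = p ^ m"
    using \<open>p > 0\<close> by (simp add: card_PiE carrier_integer_mod_group)
  show "s \<otimes>\<^bsub>A\<^esub> t = t \<otimes>\<^bsub>A\<^esub> s" if st: "s \<in> carrier A" "t \<in> carrier A"
  proof -
    have cl: "f s \<in> carrier ?P" "f t \<in> carrier ?P" using f(1) st by (auto simp: hom_def)
    have "f s \<otimes>\<^bsub>?P\<^esub> f t = f t \<otimes>\<^bsub>?P\<^esub> f s"
      using cl by (auto simp: PiE_iff add.commute intro!: restrict_ext)
    then have "f (s \<otimes>\<^bsub>A\<^esub> t) = f (t \<otimes>\<^bsub>A\<^esub> s)" using f(1) st by (simp add: hom_mult)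
    then show ?thesis using f(2) st by (auto simp: bij_betw_def inj_on_def)
  qed
qed

text \<open>Permutations are functions on the whole type, whereas \<open>BijGroup E\<close> consists
  of functions extensional on \<open>E\<close>; hence the restriction. This gives access to the
  orbit-stabilizer theorem.\<close>

lemma permutation_group_action:
  assumes "group A" "carrier A \<subseteq> {g. g permutes E}" "monoid.mult A = (\<circ>)"
  shows "group_action A E (\<lambda>g. restrict g E)"
proof -
  have perm: "g permutes E" if "g \<in> carrier A" for g using assms(2) that by blast
  have Bij: "restrict g E \<in> Bij E" if "g \<in> carrier A" for g
    using permutes_imp_bij[OF perm[OF that]] by (simp add: Bij_def cong: bij_betw_cong)
  have "(\<lambda>g. restrict g E) \<in> hom A (BijGroup E)"
  proof (rule homI)
    fix g h assume "g \<in> carrier A" "h \<in> carrier A"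
    then show "restrict (g \<otimes>\<^bsub>A\<^esub> h) E = restrict g E \<otimes>\<^bsub>BijGroup E\<^esub> restrict h E"
      using Bij perm by (auto simp: BijGroup_def assms(3) compose_def permutes_in_image intro!: ext)
  qed (simp add: BijGroup_def Bij)
  then show ?thesis
    using assms(1) group_BijGroup by (simp add: group_action_def group_hom_def group_hom_axioms_def)
qed

section \<open>Orbits of the normal Sylow subgroup and the vanishing theorem\<close>

theorem theorem6p10:
  fixes p n m :: nat
    and G :: "(nat \<Rightarrow> nat) monoid"
    and H S :: "(nat \<Rightarrow> nat) set"
    and \<D> :: "(nat \<Rightarrow> nat) set set"
  assumes "prime p"
    and "p dvd n" and "\<not> p\<^sup>2 dvd n"
    and "transitive_group n G"
    and "corresponding_subgroup n G H"
    and "sylow_subgroup p G S"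
    and "S \<lhd> G"
    and "restrict_group G S \<cong> product_group {..<m} (\<lambda>_. integer_mod_group p)"
    and "m \<noteq> 2"
    and "admissible G \<D>"
  shows "primary_torsion p (Sha2 \<D> G (J_mod G H) (J_act G)) =
         {\<one>\<^bsub>Sha2 \<D> G (J_mod G H) (J_act G)\<^esub>}"
proof -
  define E where "E = {1..n}"
  obtain K where K: "subgroup K (sym_group n)" "G = restrict_group (sym_group n) K"
    using assms(4) by (auto simp: transitive_group_def)
  have trans: "\<exists>g\<in>carrier G. g i = j" if "i \<in> E" "j \<in> E" for i j
    using assms(4) that unfolding transitive_group_def E_def by blast
  interpret group G
    unfolding K(2) by (rule group.subgroup_imp_group[OF sym_group_is_group K(1)])
  have mult: "monoid.mult G = (\<circ>)" and one: "\<one>\<^bsub>G\<^esub> = id"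
    using K(2) by (simp_all add: sym_group_mult sym_group_one)
  have perm: "g permutes E" if "g \<in> carrier G" for g
    using subgroup.mem_carrier[OF K(1)] that K(2) by (simp add: sym_group_carrier E_def)
  have fin: "finite (carrier G)"
    using finite_permutations[of E] perm unfolding E_def by (auto intro: finite_subset[of _ "{g. g permutes {1..n}}"])
  have inE: "g j \<in> E" if "g \<in> carrier G" "j \<in> E" for g j
    using permutes_in_image[OF perm[OF that(1)]] that(2) by blast
  have inv_l: "(inv\<^bsub>G\<^esub> g) (g j) = j" and inv_r: "g ((inv\<^bsub>G\<^esub> g) j) = j" if "g \<in> carrier G" for g j
    using l_inv[OF that] r_inv[OF that] by (simp_all add: mult one fun_eq_iff)
  obtain i where i: "i \<in> E" "H = stabilizer G (\<lambda>g. g) i"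
    using assms(5) by (auto simp: corresponding_subgroup_def E_def)
  have H_mem: "h \<in> H \<longleftrightarrow> h \<in> carrier G \<and> h i = i" for h
    by (simp add: i(2) stabilizer_def)
  have H: "subgroup H G"
  proof (rule subgroupI)
    have "\<one>\<^bsub>G\<^esub> \<in> H" unfolding H_mem using one_closed by (simp add: one)
    then show "H \<noteq> {}" by blast
  next
    fix h assume h: "h \<in> H"
    then have "(inv\<^bsub>G\<^esub> h) i = i" using inv_l[of h i] by (simp add: H_mem)
    then show "inv\<^bsub>G\<^esub> h \<in> H" using h by (simp add: H_mem)
  next
    fix h h' assume "h \<in> H" "h' \<in> H"
    then show "h \<otimes>\<^bsub>G\<^esub> h' \<in> H" using m_closed[of h h'] by (simp add: H_mem) (simp add: mult)
  qed (auto simp: H_mem)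
  interpret induced_module G H
    by (intro induced_module.intro induced_module_axioms.intro is_group H)
  interpret mod: group_module G J "J_act G" by (rule group_module_J_mod)
  have S: "subgroup S G" "card S = p ^ multiplicity p (order G)"
    using assms(6) by (auto simp: sylow_subgroup_def)
  have SG: "s \<in> carrier G" if "s \<in> S" for s using S(1) that by (rule subgroup.mem_carrier)
  have p0: "p > 0" using assms(1) by (rule prime_gt_0_nat)
  note elem = elementary_abelian_card_comm[OF assms(8) p0 subgroup_imp_group[OF S(1)], simplified]
  interpret act: group_action "restrict_group G S" E "\<lambda>g. restrict g E"
    by (rule permutation_group_action[OF subgroup_imp_group[OF S(1)]]) (use SG perm mult in auto)
  have stab_eq: "stabilizer (restrict_group G S) (\<lambda>g. restrict g E) j = {s \<in> S. s j = j}" if "j \<in> E" for j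
    using that by (auto simp: stabilizer_def)
  have orb_eq: "orbit (restrict_group G S) (\<lambda>g. restrict g E) j = (\<lambda>s. s j) ` S" if "j \<in> E" for j
    using that by (auto simp: orbit_def)
  have orb_stab: "card ((\<lambda>s. s j) ` S) * card {s \<in> S. s j = j} = card S" if "j \<in> E" for j
    using act.orbit_stabilizer_theorem[OF that] that by (simp add: stab_eq orb_eq order_def)
  have conj: "g \<otimes>\<^bsub>G\<^esub> s \<otimes>\<^bsub>G\<^esub> inv\<^bsub>G\<^esub> g \<in> S" if "g \<in> carrier G" "s \<in> S" for g s
    using normal.inv_op_closed2[OF assms(7)] that by blast
  \<comment> \<open>Since S is normal, an element g taking j to k maps the S-orbit of j into that of
    k. By transitivity all S-orbits have the same size d.\<close>
  have orb_le: "card ((\<lambda>s. s j) ` S) \<le> card ((\<lambda>s. s k) ` S)" if jk: "j \<in> E" "k \<in> E" for j k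
  proof -
    obtain g where g: "g \<in> carrier G" "g j = k" using trans[OF jk] by blast
    have "g ` (\<lambda>s. s j) ` S \<subseteq> (\<lambda>s. s k) ` S"
    proof clarify
      fix s assume "s \<in> S"
      then show "g (s j) \<in> (\<lambda>s. s k) ` S"
        using conj[OF g(1)] inv_l[OF g(1), of j] by (intro image_eqI[of _ _ "g \<otimes>\<^bsub>G\<^esub> s \<otimes>\<^bsub>G\<^esub> inv\<^bsub>G\<^esub> g"]) (auto simp: mult g(2)[symmetric])
    qed
    moreover have "inj_on g ((\<lambda>s. s j) ` S)" using permutes_inj[OF perm[OF g(1)]] inj_on_subset by blast
    moreover have "finite ((\<lambda>s. s k) ` S)" using finite_subset[OF subgroup.subset[OF S(1)] fin] by simp
    ultimately show ?thesis using card_inj_on_le by blast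
  qed
  define d where "d = card ((\<lambda>s. s i) ` S)"
  have d: "card ((\<lambda>s. s j) ` S) = d" if "j \<in> E" for j
    using orb_le[OF that i(1)] orb_le[OF i(1) that] by (simp add: d_def)
  have "d * card (orbits (restrict_group G S) E (\<lambda>g. restrict g E)) = card E"
  proof -
    have "finite (orbits (restrict_group G S) E (\<lambda>g. restrict g E))"
      by (simp add: orbits_def setcompr_eq_image E_def)
    moreover have "card C = d" if "C \<in> orbits (restrict_group G S) E (\<lambda>g. restrict g E)" for C
      using that orb_eq d by (auto simp: orbits_def)
    ultimately have "d * card (orbits (restrict_group G S) E (\<lambda>g. restrict g E)) =
        card (\<Union> (orbits (restrict_group G S) E (\<lambda>g. restrict g E)))"
      by (intro card_partition) (use act.disjoint_union act.orbits_coverture in \<open>auto simp: E_def\<close>)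
    then show ?thesis by (simp add: act.orbits_coverture)
  qed
  then have dn: "d dvd n" by (metis E_def card_atLeastAtMost diff_Suc_1 dvd_triv_left)
  \<comment> \<open>The common orbit size divides n as well as the order of S, so it is a power of p
    not divisible by p^2.\<close>
  have "d dvd p ^ m" using orb_stab[OF i(1)] elem(1) by (metis d_def dvd_triv_left)
  then obtain a where a: "d = p ^ a" using assms(1) divides_primepow_nat by blast
  have "a \<le> 1"
  proof (rule ccontr)
    assume "\<not> a \<le> 1"
    then have "p\<^sup>2 dvd d" unfolding a by (intro le_imp_power_dvd) simp
    then show False using dn assms(3) dvd_trans by blast
  qed
  \<comment> \<open>The coset H x corresponds to the point obtained from i by the inverse of x; the
    condition on conjugates is that s fixes this point.\<close>
  have conj_H: "x \<otimes>\<^bsub>G\<^esub> s \<otimes>\<^bsub>G\<^esub> inv\<^bsub>G\<^esub> x \<in> H \<longleftrightarrow> s ((inv\<^bsub>G\<^esub> x) i) = (inv\<^bsub>G\<^esub> x) i"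
    if x: "x \<in> carrier G" and s: "s \<in> S" for x s
  proof -
    have "x \<otimes>\<^bsub>G\<^esub> s \<otimes>\<^bsub>G\<^esub> inv\<^bsub>G\<^esub> x \<in> H \<longleftrightarrow> x (s ((inv\<^bsub>G\<^esub> x) i)) = i"
      using x SG[OF s] m_closed[of "x \<otimes>\<^bsub>G\<^esub> s" "inv\<^bsub>G\<^esub> x"] m_closed[of x s] by (simp add: H_mem) (simp add: mult)
    also have "\<dots> \<longleftrightarrow> s ((inv\<^bsub>G\<^esub> x) i) = (inv\<^bsub>G\<^esub> x) i" using inv_l[OF x] inv_r[OF x] by metis
    finally show ?thesis .
  qed
  \<comment> \<open>By transitivity such an s fixes every point of \<open>E\<close>, and a
    permutation of \<open>E\<close> fixing all points is the identity.\<close>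
  have core: "s = \<one>\<^bsub>G\<^esub>"
    if s: "s \<in> S" and *: "\<And>x. x \<in> carrier G \<Longrightarrow> x \<otimes>\<^bsub>G\<^esub> s \<otimes>\<^bsub>G\<^esub> inv\<^bsub>G\<^esub> x \<in> H" for s
  proof -
    have "s j = j" if j: "j \<in> E" for j
    proof -
      obtain g where g: "g \<in> carrier G" "g i = j" using trans[OF i(1) j] by blast
      then show ?thesis using *[of "inv\<^bsub>G\<^esub> g"] conj_H[of "inv\<^bsub>G\<^esub> g" s] s by simp
    qed
    moreover have "s j = j" if "j \<notin> E" for j using permutes_not_in[OF perm[OF SG[OF s]] that] .
    ultimately show ?thesis unfolding one by (auto simp: fun_eq_iff)
  qed
  have index: "card S = p * card {s \<in> S. x \<otimes>\<^bsub>G\<^esub> s \<otimes>\<^bsub>G\<^esub> inv\<^bsub>G\<^esub> x \<in> H}" if m: "m \<ge> 3" and x: "x \<in> carrier G" for x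
  proof -
    \<comment> \<open>With orbits of size 1, S would act trivially and so be trivial by
      \<open>core\<close>, against m \<ge> 3. Hence d = p, and orbit-stabilizer gives the
      index.\<close>
    have "a \<noteq> 0"
    proof
      assume "a = 0"
      then have d1: "d = 1" using a by simp
      have "s j = j" if s: "s \<in> S" and j: "j \<in> E" for s j
      proof -
        obtain y where "(\<lambda>s. s j) ` S = {y}" using d[OF j] d1 by (auto simp: card_1_singleton_iff)
        moreover have "id \<in> S" using subgroup.one_closed[OF S(1)] by (simp add: one)
        ultimately show ?thesis using s by (metis id_apply imageI singletonD)
      qed
      then have "S \<subseteq> {\<one>\<^bsub>G\<^esub>}" using core conj_H inE[OF inv_closed i(1)] by blast
      then have "card S \<le> 1" by (metis card_mono card.empty card_insert_disjoint empty_iff finite.emptyI finite.insertI One_nat_def)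
      then show False using elem(1) one_less_power[OF prime_gt_1_nat[OF assms(1)], of m] m by simp
    qed
    then have "d = p" using \<open>a \<le> 1\<close> a by (cases a) auto
    moreover have "{s \<in> S. x \<otimes>\<^bsub>G\<^esub> s \<otimes>\<^bsub>G\<^esub> inv\<^bsub>G\<^esub> x \<in> H} = {s \<in> S. s ((inv\<^bsub>G\<^esub> x) i) = (inv\<^bsub>G\<^esub> x) i}"
      using conj_H[OF x] by blast
    moreover have "(inv\<^bsub>G\<^esub> x) i \<in> E" using inE[OF inv_closed[OF x] i(1)] .
    ultimately show ?thesis using orb_stab[of "(inv\<^bsub>G\<^esub> x) i"] d by simp
  qed
  have \<D>: "subgroup D G" if "D \<in> \<D>" for D using assms(10) that by (simp add: admissible_def)
  have cyclic: "generate G {s} \<in> \<D>" if "s \<in> S" for s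
  proof -
    have "cyclic_group (restrict_group G (generate G {s}))"
      using cyclic_group_generated[of s] SG[OF that] by (simp add: subgroup_generated_def)
    then show ?thesis
      using assms(10) generate_is_subgroup[of "{s}"] SG[OF that] by (simp add: admissible_def)
  qed
  show ?thesis
  proof (rule mod.primary_torsion_Sha2_trivialI[OF \<D>])
    fix c e
    assume c: "c \<in> carrier (cocycles2 G J (J_act G))"
      and loc: "\<And>D. D \<in> \<D> \<Longrightarrow> restrict c (D \<times> D) \<in> coboundaries2 (restrict_group G D) J (J_act G)"
      and tors: "c [^]\<^bsub>cocycles2 G J (J_act G)\<^esub> p ^ e \<in> coboundaries2 G J (J_act G)"
    show "c \<in> coboundaries2 G J (J_act G)"
      by (rule torsion_cocycle_is_coboundary[OF fin c S elem(1) assms(1,9) elem(2) index core loc[OF cyclic] tors])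
  qed
qed

end
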